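(* Let $d_j$ ($j\geqslant1$) be real numbers with $0<d^-<d_j<d^+$, and let $p(z)=\sum_{n\geqslant0}p_nz^n=\exp\{\sum_{j\geqslant1}\frac{d_j}{j}z^j\}$. Let $f(z)=\sum_{n\geqslant0}a_nz^n$ be analytic for $|z|<1$, and set $S(f;m)=\sum_{k=1}^m a_k k p_{m-k}$. Then for $n\geqslant1$, $$\left|\frac1{p_n}\sum_{k=0}^n a_kp_{n-k}-f(e^{-1/n})-\frac{S(f;n)}{np_n}\right|\leqslant c\left(\frac1{n^\theta}\sum_{j=1}^n\frac{|S(f;j)|}{p(e^{-1/j})}j^{\theta-1}+\frac{1}{p(e^{-1/n})}\sum_{j>n}\frac{|S(f;j)|}{j}e^{-j/n}\right),$$ where $\theta=\min\{d^-,1\}$ and $c=c(d^+,d^-)$ is a constant depending only on $d^+$ and $d^-$. *)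

theory Defs
  imports "HOL-Analysis.Analysis"
begin

(* Polymorphic, so that it serves both on the complex unit disc and, as a real
   number, at the points exp (- 1 / j).  The value d 0 is never used. *)
definition gen_fun :: "(nat \<Rightarrow> real) \<Rightarrow> 'a::{real_normed_field, banach} \<Rightarrow> 'a" where
  "gen_fun d z = exp (\<Sum>j. of_real (d (Suc j) / real (Suc j)) * z ^ Suc j)"

definition S_sum :: "(nat \<Rightarrow> complex) \<Rightarrow> (nat \<Rightarrow> real) \<Rightarrow> nat \<Rightarrow> complex" where
  "S_sum a p m = (\<Sum>k = 1..m. a k * of_nat k * of_real (p (m - k)))"

end

theory Submission
  imports Defs "HOL-Real_Asymp.Real_Asymp" "HOL-Complex_Analysis.Cauchy_Integral_Formula"
begin

text \<open>
  Since z f'(z) p(z) has the coefficients S(f;m), both the Voronoi mean and f(Y), with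
  Y = exp (-1/n), are linear in the S(f;j): the weight of S(f;j) in the mean is h(n)/p(n), where
  h(z) = p(z) g(z) and g(z) is the integral of u^(j-1)/p(u) from 0 to z, and its weight in f(Y)
  is g(Y).  For j > n the first weight vanishes and g(Y) is estimated directly.  For j < n the
  coefficients H(k) of p(z) (g(z) - g(Y)) obey n H(n) = (SUM k<n. d(n-k) H(k)), so it
  suffices to bound the sum of the |H(k)|.

  Now h(z) is the integral over 0 <= x <= 1 of x^(j-1) z^j p(z)/p(xz), and p(z)/p(xz) has
  nonnegative coefficients.  Writing p(z) = (1-z)^(-\<theta>) W(z), where W has nonnegative coefficients
  because \<theta> <= d(j), the difference z^j p(z)/p(xz) - p(z)/p(x) equals W(z)/W(xz) times a series
  whose absolute coefficient sum is O(1 + (j(1-x))^\<theta>).  That sum is controlled by sign and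
  monotonicity properties of binomial coefficients alone, since 0 < \<theta> <= 1.
\<close>

unbundle no vec_syntax
unbundle fps_syntax

subsection \<open>Coefficients of exponentials of power series\<close>

text \<open>The recurrence helps for j < n because it averages: it gives |H(n)| <= (K/n) times the
  sum of the |H(k)| with k < n, where the natural number K bounds the weights, while p(n) itself is
  at least a constant times p(Y)/n. The two factors 1/n cancel, so the sum of the |H(k)| need only
  be bounded relative to p(Y). H(z) = p(z) (g(z) - g(Y)) solves z H' = (SUM d(i) z^i) H + z^j. The
  forcing term z^j misses the coefficient n when j < n, but not when j = n; there h(n) is exactly
  1/n, and its share of the mean is the subtracted S(f;n)/(n p(n)). The coefficients of
  (1-z)^(-\<theta>) have no finite sum, so absolute sums are cut off at n and compared with values
  at Y, where Y^k >= 1/e for k <= n. Likewise the integral over x is split at Y: below Y the term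
  p(z)/p(x) is subtracted, and it integrates to g(Y) p(z); the piece above Y has length at most 1/n
  and is bounded without cancellation. The saving n^(-\<theta>) comes from W(Y) = p(Y)
  (1-Y)^\<theta>.\<close>

fun ecoef :: "(nat \<Rightarrow> real) \<Rightarrow> nat \<Rightarrow> real" where
  "ecoef d n = (if n = 0 then 1 else (\<Sum>k<n. d (n - k) * ecoef d k) / real n)"

declare ecoef.simps [simp del]

text \<open>This is exp (SUM d(i) z^i / i), given by the recurrence that z F' = (SUM d(i) z^i) F
  imposes on its coefficients. Coefficient arguments thus stay formal; \<open>eval_efps\<close>
  provides the agreement with \<open>gen_fun\<close>.\<close>

definition efps :: "(nat \<Rightarrow> real) \<Rightarrow> real fps" where
  "efps d = Abs_fps (ecoef d)"

definition lfps :: "(nat \<Rightarrow> real) \<Rightarrow> real fps" where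
  "lfps d = Abs_fps (\<lambda>n. d (Suc n))"

lemma efps_nth_0 [simp]: "efps d $ 0 = 1"
  by (simp add: efps_def ecoef.simps)

lemma efps_rec: "real n * efps d $ n = (\<Sum>k<n. d (n - k) * efps d $ k)" if "n > 0"
  using that by (simp add: efps_def ecoef.simps[of d n])

lemma fps_deriv_efps: "fps_deriv (efps d) = lfps d * efps d"
proof (rule fps_ext)
  fix n
  have "fps_deriv (efps d) $ n = real (Suc n) * efps d $ Suc n"
    by simp
  also have "\<dots> = (\<Sum>k<Suc n. d (Suc n - k) * efps d $ k)"
    by (rule efps_rec) simp
  also have "\<dots> = (\<Sum>i=0..n. d (Suc i) * efps d $ (n - i))"
    by (rule sum.reindex_bij_witness[of _ "\<lambda>i. n - i" "\<lambda>i. n - i"]) (auto simp: Suc_diff_le)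
  also have "\<dots> = (lfps d * efps d) $ n"
    by (simp add: fps_mult_nth lfps_def)
  finally show "fps_deriv (efps d) $ n = (lfps d * efps d) $ n" .
qed

lemma fps_linear_ode_unique:
  fixes F G L :: "real fps"
  assumes "fps_deriv F = L * F" "fps_deriv G = L * G" "F $ 0 = G $ 0"
  shows "F = G"
proof (rule fps_ext)
  fix n
  show "F $ n = G $ n"
  proof (induction n rule: less_induct)
    case (less n)
    show ?case
    proof (cases n)
      case 0 then show ?thesis using assms by simp
    next
      case (Suc m)
      have "fps_deriv F $ m = fps_deriv G $ m"
        unfolding assms fps_mult_nth
        by (rule sum.cong) (use less Suc in auto)
      then show ?thesis using Suc by simp
    qed
  qed
qed

text \<open>Both sides solve the same linear equation. All factorisations rest on this: negated
  weights give the reciprocal series, and together with \<open>efps_scale\<close> the weights d i *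
  (1 - x ^ i) give p(z)/p(xz).\<close>

lemma efps_add: "efps (\<lambda>i. d i + e i) = efps d * efps e"
proof (rule fps_linear_ode_unique[where L = "lfps d + lfps e"])
  have "lfps (\<lambda>i. d i + e i) = lfps d + lfps e"
    by (simp add: lfps_def fps_eq_iff)
  then show "fps_deriv (efps (\<lambda>i. d i + e i)) = (lfps d + lfps e) * efps (\<lambda>i. d i + e i)"
    by (simp add: fps_deriv_efps)
qed (auto simp: fps_deriv_efps algebra_simps)

lemma efps_scale: "efps (\<lambda>i. d i * x ^ i) $ n = x ^ n * efps d $ n"
proof (induction n rule: less_induct)
  case (less n)
  show ?case
  proof (cases "n = 0")
    case False
    have "real n * efps (\<lambda>i. d i * x ^ i) $ n
        = (\<Sum>k<n. d (n - k) * x ^ (n - k) * (x ^ k * efps d $ k))"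
      using False by (auto simp: efps_rec less intro!: sum.cong)
    also have "\<dots> = (\<Sum>k<n. x ^ n * (d (n - k) * efps d $ k))"
      by (rule sum.cong) (auto simp: algebra_simps simp flip: power_add)
    also have "\<dots> = x ^ n * (real n * efps d $ n)"
      using False by (simp add: efps_rec sum_distrib_left)
    finally show ?thesis using False by simp
  qed auto
qed

text \<open>A majorant argument: the recurrence uses only sums and products, so the bound propagates
  by induction.\<close>

lemma efps_abs_le:
  assumes "\<And>i. i \<ge> 1 \<Longrightarrow> \<bar>d i\<bar> \<le> e i"
  shows "\<bar>efps d $ n\<bar> \<le> efps e $ n"
proof (induction n rule: less_induct)
  case (less n)
  show ?case
  proof (cases "n = 0")
    case False
    have "real n * \<bar>efps d $ n\<bar> = \<bar>\<Sum>k<n. d (n - k) * efps d $ k\<bar>"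
      using False efps_rec[of n d] by (metis abs_mult abs_of_nat gr0I)
    also have "\<dots> \<le> (\<Sum>k<n. \<bar>d (n - k)\<bar> * \<bar>efps d $ k\<bar>)"
      by (rule order_trans[OF sum_abs]) (simp add: abs_mult)
    also have "\<dots> \<le> (\<Sum>k<n. e (n - k) * efps e $ k)"
    proof (rule sum_mono)
      fix k assume "k \<in> {..<n}"
      then have "\<bar>d (n - k)\<bar> \<le> e (n - k)" "\<bar>efps d $ k\<bar> \<le> efps e $ k"
        using assms[of "n - k"] less[of k] by auto
      then show "\<bar>d (n - k)\<bar> * \<bar>efps d $ k\<bar> \<le> e (n - k) * efps e $ k"
        by (intro mult_mono) auto
    qed
    also have "\<dots> = real n * efps e $ n"
      using False by (simp add: efps_rec)
    finally show ?thesis using False by simp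
  qed auto
qed

lemma efps_nonneg: "efps d $ n \<ge> 0" if "\<And>i. i \<ge> 1 \<Longrightarrow> d i \<ge> 0"
proof -
  have "\<bar>efps d $ n\<bar> \<le> efps d $ n" by (rule efps_abs_le) (use that in auto)
  then show ?thesis by linarith
qed

text \<open>Constant weights t give (1-z)^(-t), and this is the usual recursion of binomial
  coefficients. It follows by comparing the sum recurrence at n and at n + 1.\<close>

lemma efps_const_Suc: "real (Suc n) * efps (\<lambda>_. t) $ Suc n = (real n + t) * efps (\<lambda>_. t) $ n"
proof -
  have "real (Suc n) * efps (\<lambda>_. t) $ Suc n = t * (\<Sum>k<n. efps (\<lambda>_. t) $ k) + t * efps (\<lambda>_. t) $ n"
    by (subst efps_rec) (auto simp: sum_distrib_left)
  moreover have "t * (\<Sum>k<n. efps (\<lambda>_. t) $ k) = real n * efps (\<lambda>_. t) $ n"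
    by (cases "n = 0") (auto simp: efps_rec sum_distrib_left)
  ultimately show ?thesis by (simp add: algebra_simps)
qed

section \<open>Radii of convergence, and agreement of the formal series with
  \<open>gen_fun\<close>\<close>

lemma conv_radius_efps_const: "t > 0 \<Longrightarrow> fps_conv_radius (efps (\<lambda>_. t)) \<ge> 1"
proof -
  assume t: "t > 0"
  let ?c = "\<lambda>n. efps (\<lambda>_. t) $ n"
  have pos: "?c n > 0" for n
  proof (induction n)
    case (Suc n)
    have "real (Suc n) * ?c (Suc n) > 0"
      unfolding efps_const_Suc using Suc t by (intro mult_pos_pos) auto
    then show ?case by (simp add: zero_less_mult_iff)
  qed simp
  have "?c n / ?c (Suc n) = real (Suc n) / (real n + t)" for n
  proof -
    have "real n + t > 0" using t by linarith
    then show ?thesis using efps_const_Suc[of n t] pos[of "Suc n"] by (simp add: field_simps)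
  qed
  then have "(\<lambda>n. norm (?c n / ?c (Suc n))) = (\<lambda>n. real (Suc n) / (real n + t))"
    using t by (auto simp: fun_eq_iff)
  moreover have "(\<lambda>n. real (Suc n) / (real n + t)) \<longlonglongrightarrow> 1"
    by real_asymp
  ultimately have "conv_radius ?c = 1"
    using pos by (intro conv_radius_ratio_limit_nonzero[where c = 1])
      (auto simp: one_ereal_def less_imp_neq[symmetric])
  then show ?thesis by (simp add: fps_conv_radius_def)
qed

lemma conv_radius_mono:
  fixes f g :: "nat \<Rightarrow> real"
  assumes "\<And>n. \<bar>f n\<bar> \<le> g n"
  shows "conv_radius g \<le> conv_radius f"
  proof (rule conv_radius_geI_ex)
  fix r :: real assume r: "0 < r" "ereal r < conv_radius g"
  have "summable (\<lambda>n. norm (g n * r ^ n))"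
    using r by (intro abs_summable_in_conv_radius) auto
  moreover have "norm (f n * r ^ n) \<le> norm (g n * r ^ n)" for n
    using assms[of n] r by (auto simp: abs_mult intro!: mult_right_mono)
  ultimately have "summable (\<lambda>n. f n * r ^ n)"
    using summable_comparison_test'[of "\<lambda>n. norm (g n * r ^ n)" 0 "\<lambda>n. f n * r ^ n"] by auto
  then show "\<exists>z. norm z = r \<and> summable (\<lambda>n. f n * z ^ n)"
    using r by (intro exI[of _ r]) auto
qed


lemma conv_radius_bounded_coeffs:
  fixes d :: "nat \<Rightarrow> real"
  assumes "\<And>i. i \<ge> 1 \<Longrightarrow> \<bar>d i\<bar> \<le> K"
  shows "conv_radius (\<lambda>n. d (Suc n)) \<ge> 1"
proof -
  have "conv_radius (\<lambda>_. K) \<le> conv_radius (\<lambda>n. d (Suc n))"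
    by (rule conv_radius_mono) (use assms in auto)
  moreover have "1 \<le> conv_radius (\<lambda>_. K)"
  proof (rule conv_radius_geI_ex)
    fix r :: real assume "0 < r" "ereal r < 1"
    then show "\<exists>z. norm z = r \<and> summable (\<lambda>n. K * z ^ n)"
      by (intro exI[of _ r]) (auto intro!: summable_mult summable_geometric)
  qed
  ultimately show ?thesis by order
qed

text \<open>Since division by 0 yields 0, the constant coefficient vanishes whatever
  \<open>d 0\<close> is, so this is the exponent of \<open>gen_fun\<close>.\<close>

definition log_fps :: "(nat \<Rightarrow> real) \<Rightarrow> real fps" where
  "log_fps d = Abs_fps (\<lambda>n. d n / real n)"

lemma fps_deriv_log_fps: "fps_deriv (log_fps d) = lfps d"
  by (simp add: log_fps_def lfps_def fps_eq_iff)

text \<open>The series is majorised by (1-z)^(-(|K|+1)); the added 1 keeps the exponent parameter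
  positive, as \<open>conv_radius_efps_const\<close> demands.\<close>

lemma conv_radius_efps:
  assumes "\<And>i. i \<ge> 1 \<Longrightarrow> \<bar>d i\<bar> \<le> K"
  shows "fps_conv_radius (efps d) \<ge> 1" "fps_conv_radius (lfps d) \<ge> 1"
    "fps_conv_radius (log_fps d) \<ge> 1"
proof -
  have *: "\<bar>d i\<bar> \<le> \<bar>K\<bar> + 1" if "i \<ge> 1" for i using assms[of i] that by linarith
  have "fps_conv_radius (efps (\<lambda>_. \<bar>K\<bar> + 1)) \<le> fps_conv_radius (efps d)"
    unfolding fps_conv_radius_def by (rule conv_radius_mono) (rule efps_abs_le, rule *)
  then show "fps_conv_radius (efps d) \<ge> 1"
    using conv_radius_efps_const[of "\<bar>K\<bar> + 1"] by fastforce
  show 1: "fps_conv_radius (lfps d) \<ge> 1"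
    using conv_radius_bounded_coeffs[of d K, OF assms] by (simp add: fps_conv_radius_def lfps_def)
  have "conv_radius (\<lambda>n. \<bar>fps_nth (lfps d) n\<bar>) \<le> conv_radius (\<lambda>n. fps_nth (fps_shift 1 (log_fps d)) n)"
    by (rule conv_radius_mono) (auto simp: lfps_def log_fps_def divide_le_eq_1 field_simps)
  then have "fps_conv_radius (lfps d) \<le> fps_conv_radius (fps_shift 1 (log_fps d))"
    using conv_radius_norm[of "fps_nth (lfps d)"] unfolding fps_conv_radius_def by simp
  then show "fps_conv_radius (log_fps d) \<ge> 1" using 1 by simp
qed

lemma gen_fun_eq_exp_eval_fps:
  assumes "\<And>i. i \<ge> 1 \<Longrightarrow> \<bar>d i\<bar> \<le> K" "\<bar>x\<bar> < 1"
  shows "gen_fun d x = exp (eval_fps (log_fps d) x)"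
proof -
  have "ereal (norm x) < fps_conv_radius (log_fps d)"
    using conv_radius_efps(3)[of d K, OF assms(1)] assms(2)
    by (metis less_ereal.simps(1) one_ereal_def order_less_le_trans real_norm_def)
  then have "(\<lambda>n. log_fps d $ n * x ^ n) sums eval_fps (log_fps d) x"
    by (rule sums_eval_fps)
  then have "(\<lambda>n. log_fps d $ Suc n * x ^ Suc n) sums eval_fps (log_fps d) x"
    using sums_Suc_iff[of "\<lambda>n. log_fps d $ n * x ^ n" "eval_fps (log_fps d) x"]
    by (simp add: log_fps_def)
  then show ?thesis by (simp add: gen_fun_def log_fps_def sums_iff)
qed

text \<open>\<open>?F\<close> is the quotient of the two sides. The formal equation F' = L F makes
  its derivative vanish on the interval, and its value at 0 is 1.\<close>

lemma eval_efps:
  assumes d: "\<And>i. i \<ge> 1 \<Longrightarrow> \<bar>d i\<bar> \<le> K" and x: "\<bar>x\<bar> < 1"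
  shows "eval_fps (efps d) x = gen_fun d x"
proof -
  let ?F = "\<lambda>x. eval_fps (efps d) x * exp (- eval_fps (log_fps d) x)"
  have R: "ereal (norm y) < fps_conv_radius (efps d)" "ereal (norm y) < fps_conv_radius (lfps d)"
    "ereal (norm y) < fps_conv_radius (log_fps d)" if "\<bar>y\<bar> < 1" for y :: real
    using conv_radius_efps[of d K, OF d] that
    by (metis less_ereal.simps(1) one_ereal_def order_less_le_trans real_norm_def)+
  have der: "(?F has_field_derivative 0) (at y within ball 0 1)" if "y \<in> ball 0 1" for y
  proof -
    from that have y: "\<bar>y\<bar> < 1" by simp
    show ?thesis
      by (rule derivative_eq_intros has_field_derivative_eval_fps R[OF y] refl)+
         (simp add: fps_deriv_efps fps_deriv_log_fps eval_fps_mult[OF R(2,1)[OF y]])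
  qed
  obtain c where c: "\<And>y. y \<in> ball 0 1 \<Longrightarrow> ?F y = c"
    using has_field_derivative_zero_constant[of "ball 0 1" ?F] der by auto
  have "c = 1" using c[of 0] by (simp add: eval_fps_at_0 log_fps_def)
  then have "?F x = 1" using c[of x] x by auto
  then show ?thesis
    by (simp add: gen_fun_eq_exp_eval_fps[OF d x] exp_minus field_simps)
qed

lemma efps_sums:
  assumes "\<And>i. i \<ge> 1 \<Longrightarrow> \<bar>d i\<bar> \<le> K" "\<bar>x\<bar> < 1"
  shows "(\<lambda>n. efps d $ n * x ^ n) sums gen_fun d x"
proof -
  have "ereal (norm x) < fps_conv_radius (efps d)"
    using conv_radius_efps(1)[of d K, OF assms(1)] assms(2)
    by (metis less_ereal.simps(1) one_ereal_def order_less_le_trans real_norm_def)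
  from sums_eval_fps[OF this] show ?thesis using eval_efps[OF assms] by simp
qed

lemma gen_fun_pos: "gen_fun d x > 0" for x :: real
  by (simp add: gen_fun_def)

lemma gen_fun_summable:
  assumes "\<And>i. i \<ge> 1 \<Longrightarrow> \<bar>d i\<bar> \<le> K" "\<bar>x\<bar> < (1::real)"
  shows "summable (\<lambda>j. d (Suc j) / real (Suc j) * x ^ Suc j)"
proof -
  have "ereal (norm x) < fps_conv_radius (log_fps d)"
    using conv_radius_efps(3)[of d K, OF assms(1)] assms(2)
    by (metis less_ereal.simps(1) one_ereal_def order_less_le_trans real_norm_def)
  from summable_fps[OF this] show ?thesis
    using summable_Suc_iff[of "\<lambda>n. log_fps d $ n * x ^ n"]
    by (simp add: log_fps_def)
qed

lemma gen_fun_add: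
  assumes "\<And>i. i \<ge> 1 \<Longrightarrow> \<bar>d i\<bar> \<le> K" "\<And>i. i \<ge> 1 \<Longrightarrow> \<bar>e i\<bar> \<le> L" "\<bar>x\<bar> < (1::real)"
  shows "gen_fun (\<lambda>i. d i + e i) x = gen_fun d x * gen_fun e x"
  using suminf_add[OF gen_fun_summable[of d K x] gen_fun_summable[of e L x]] assms
  by (simp add: gen_fun_def exp_add[symmetric] add_divide_distrib distrib_right)

lemma gen_fun_scale: "gen_fun (\<lambda>i. d i * x ^ i) y = gen_fun d (x * y)" for x y :: real
  by (simp add: gen_fun_def power_mult_distrib mult_ac)

lemma gen_fun_const: "gen_fun (\<lambda>_. t) x = (1 - x) powr (- t)" if "\<bar>x\<bar> < 1" for x :: real
proof -
  let ?F = "\<lambda>x. eval_fps (log_fps (\<lambda>_. t)) x + t * ln (1 - x)"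
  have R: "ereal (norm y) < fps_conv_radius (log_fps (\<lambda>_. t))" if "\<bar>y\<bar> < 1" for y :: real
    using conv_radius_efps[of "\<lambda>_. t" "\<bar>t\<bar>"] that
    by (metis less_ereal.simps(1) one_ereal_def order_less_le_trans real_norm_def order_refl)
  have der: "(?F has_field_derivative 0) (at y within ball 0 1)" if "y \<in> ball 0 1" for y
  proof -
    from that have y: "\<bar>y\<bar> < 1" by simp
    have "(\<lambda>n. y ^ n) sums (1 / (1 - y))" by (rule geometric_sums) (use y in auto)
    then have "(\<lambda>n. t * y ^ n) sums (t * (1 / (1 - y)))" by (rule sums_mult)
    then have "eval_fps (lfps (\<lambda>_. t)) y = t / (1 - y)"
      by (simp add: eval_fps_def lfps_def sums_iff)
    then show ?thesis using y
      by (auto intro!: derivative_eq_intros has_field_derivative_eval_fps R[OF y] simp: fps_deriv_log_fps)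
  qed
  obtain c where c: "\<And>y. y \<in> ball 0 1 \<Longrightarrow> ?F y = c"
    using has_field_derivative_zero_constant[of "ball 0 1" ?F] der by auto
  have "c = 0" using c[of 0] by (simp add: eval_fps_at_0 log_fps_def)
  then have "eval_fps (log_fps (\<lambda>_. t)) x = - t * ln (1 - x)" using c[of x] that by auto
  then show ?thesis
    using gen_fun_eq_exp_eval_fps[of "\<lambda>_. t" "\<bar>t\<bar>" x] that by (auto simp: powr_def)
qed

section \<open>Comparison of values at two points, and of partial coefficient sums with
  values\<close>

text \<open>The quotient of the functions for e and d has exponent coefficients (e i - d i) / i >=
  0, hence increases on [0,1). The inequality is this monotonicity with denominators
  cleared.\<close>

lemma gen_fun_mono:
  assumes "\<And>i. i \<ge> 1 \<Longrightarrow> 0 \<le> d i" "\<And>i. i \<ge> 1 \<Longrightarrow> d i \<le> e i" "\<And>i. i \<ge> 1 \<Longrightarrow> e i \<le> K"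
    "0 \<le> x" "x \<le> v" "v < (1::real)"
  shows "gen_fun d v * gen_fun e x \<le> gen_fun d x * gen_fun e v"
proof -
  have e: "\<bar>e i\<bar> \<le> K" if "i \<ge> 1" for i using assms(1-3)[OF that] by linarith
  have d: "\<bar>d i\<bar> \<le> K" if "i \<ge> 1" for i using assms(1-3)[OF that] by linarith
  note s = gen_fun_summable[of d K, OF d] gen_fun_summable[of e K, OF e]
  have "(\<Sum>j. d (Suc j) / real (Suc j) * v ^ Suc j + e (Suc j) / real (Suc j) * x ^ Suc j)
      \<le> (\<Sum>j. d (Suc j) / real (Suc j) * x ^ Suc j + e (Suc j) / real (Suc j) * v ^ Suc j)"
  proof (intro suminf_le summable_add s)
    fix j
    have "(e (Suc j) - d (Suc j)) * (v ^ Suc j - x ^ Suc j) \<ge> 0"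
      using assms by (intro mult_nonneg_nonneg) (auto simp del: power_Suc intro!: power_mono)
    then have "(e (Suc j) - d (Suc j)) * (v ^ Suc j - x ^ Suc j) / real (Suc j) \<ge> 0"
      by (rule divide_nonneg_nonneg) simp
    then show "d (Suc j) / real (Suc j) * v ^ Suc j + e (Suc j) / real (Suc j) * x ^ Suc j
      \<le> d (Suc j) / real (Suc j) * x ^ Suc j + e (Suc j) / real (Suc j) * v ^ Suc j"
      by (simp add: algebra_simps diff_divide_distrib add_divide_distrib del: power_Suc)
  qed (use assms in auto)
  moreover have "(\<Sum>j. d (Suc j) / real (Suc j) * y ^ Suc j + e (Suc j) / real (Suc j) * z ^ Suc j)
      = (\<Sum>j. d (Suc j) / real (Suc j) * y ^ Suc j) + (\<Sum>j. e (Suc j) / real (Suc j) * z ^ Suc j)"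
    if "\<bar>y\<bar> < 1" "\<bar>z\<bar> < 1" for y z
    by (rule suminf_add[symmetric]; rule s) (use that in auto)
  ultimately show ?thesis
    using assms by (simp add: gen_fun_def exp_add[symmetric] del: power_Suc)
qed

text \<open>\<open>gen_fun_mono\<close> against (1-z)^(-K). A natural K makes the growth factor an
  ordinary power.\<close>

lemma gen_fun_growth:
  assumes "\<And>i. i \<ge> 1 \<Longrightarrow> 0 \<le> d i" "\<And>i. i \<ge> 1 \<Longrightarrow> d i \<le> real K" "0 \<le> x" "x \<le> v" "v < (1::real)"
  shows "gen_fun d v \<le> gen_fun d x * ((1 - x) / (1 - v)) ^ K"
proof -
  have "gen_fun d v * (1 - x) powr (- real K) \<le> gen_fun d x * (1 - v) powr (- real K)"
    using gen_fun_mono[of d "\<lambda>_. real K" "real K" x v] assms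
    by (simp add: gen_fun_const)
  then show ?thesis
    using assms by (simp add: powr_minus powr_realpow field_simps)
qed

lemma gen_fun_mono_arg:
  assumes "\<And>i. i \<ge> 1 \<Longrightarrow> 0 \<le> d i" "\<And>i. i \<ge> 1 \<Longrightarrow> d i \<le> K" "0 \<le> x" "x \<le> v" "v < (1::real)"
  shows "gen_fun d x \<le> gen_fun d v"
  using gen_fun_mono[of "\<lambda>_. 0" d K x v] assms by (simp add: gen_fun_const)

text \<open>For k <= n the damping exp (-k/n) is at least 1/e, so the partial sum costs only a
  factor e against the damped full series.\<close>

lemma efps_sum_le:
  assumes "\<And>i. i \<ge> 1 \<Longrightarrow> 0 \<le> d i" "\<And>i. i \<ge> 1 \<Longrightarrow> d i \<le> K" "n \<ge> 1"
  shows "(\<Sum>k\<le>n. efps d $ k) \<le> exp 1 * gen_fun d (exp (- 1 / real n))"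
proof -
  let ?y = "exp (- 1 / real n)"
  have y: "0 < ?y" "?y < 1" using assms by auto
  have d: "\<bar>d i\<bar> \<le> K" if "i \<ge> 1" for i using assms(1-2)[OF that] by linarith
  have s: "(\<lambda>k. efps d $ k * ?y ^ k) sums gen_fun d ?y"
    by (rule efps_sums[OF d]) (use y in auto)
  have "(\<Sum>k\<le>n. efps d $ k) * exp (- 1) = (\<Sum>k\<le>n. efps d $ k * exp (- 1))"
    by (rule sum_distrib_right)
  also have "\<dots> \<le> (\<Sum>k\<le>n. efps d $ k * ?y ^ k)"
  proof (intro sum_mono mult_left_mono efps_nonneg)
    fix k assume "k \<in> {..n}"
    then show "exp (- 1) \<le> ?y ^ k"
      using assms(3) by (simp add: exp_of_nat_mult[symmetric] field_simps)
  qed (use assms in auto)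
  also have "\<dots> \<le> gen_fun d ?y"
    using sum_le_suminf[OF sums_summable[OF s], of "{..n}"] s y
    by (auto simp: efps_nonneg assms sums_iff)
  finally show ?thesis by (simp add: exp_minus field_simps)
qed

lemma efps_zero: "efps (\<lambda>_. 0) = 1"
  by (rule fps_linear_ode_unique[where L = 0]) (auto simp: fps_deriv_efps lfps_def fps_eq_iff fps_mult_nth)

lemma efps_uminus: "efps d * efps (\<lambda>i. - d i) = 1"
  using efps_add[of d "\<lambda>i. - d i"] by (simp add: efps_zero)

subsection \<open>Absolute coefficient sums\<close>

text \<open>The l1 norm modulo z^(n+1), which is still submultiplicative. The cut-off is essential,
  because the full coefficient sum of (1-z)^(-t) diverges for t > 0.\<close>

definition l1 :: "nat \<Rightarrow> real fps \<Rightarrow> real" where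
  "l1 n F = (\<Sum>k\<le>n. \<bar>F $ k\<bar>)"

lemma l1_nonneg: "l1 n F \<ge> 0"
  by (simp add: l1_def sum_nonneg)

lemma l1_add: "l1 n (F + G) \<le> l1 n F + l1 n G"
  by (simp add: l1_def sum.distrib[symmetric] sum_mono)

lemma l1_diff: "l1 n (F - G) \<le> l1 n F + l1 n G"
  by (simp add: l1_def sum.distrib[symmetric] sum_mono)

lemma l1_const_mult: "l1 n (fps_const c * F) = \<bar>c\<bar> * l1 n F"
  by (simp add: l1_def abs_mult sum_distrib_left)

lemma l1_mult: "l1 n (F * G) \<le> l1 n F * l1 n G"
proof -
  have "l1 n (F * G) \<le> (\<Sum>k\<le>n. \<Sum>i\<le>k. \<bar>F $ i\<bar> * \<bar>G $ (k - i)\<bar>)"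
    unfolding l1_def fps_mult_nth atLeast0AtMost
    by (intro sum_mono order_trans[OF sum_abs]) (simp add: abs_mult)
  also have "\<dots> = (\<Sum>(i,j)\<in>{(i,j). i + j \<le> n}. \<bar>F $ i\<bar> * \<bar>G $ j\<bar>)"
    by (rule sum.triangle_reindex_eq[symmetric])
  also have "\<dots> \<le> (\<Sum>(i,j)\<in>{..n} \<times> {..n}. \<bar>F $ i\<bar> * \<bar>G $ j\<bar>)"
    by (rule sum_mono2) auto
  also have "\<dots> = l1 n F * l1 n G"
    by (simp add: l1_def sum_product sum.cartesian_product)
  finally show ?thesis .
qed

lemma l1_X_power_minus_1: "l1 n (fps_X ^ j - 1) \<le> 2"
proof -
  have "l1 n (fps_X ^ j - 1) \<le> l1 n (fps_X ^ j) + l1 n 1" by (rule l1_diff)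
  also have "l1 n (fps_X ^ j) \<le> 1"
    by (auto simp: l1_def fps_X_power_nth if_distrib if_distribR cong: if_cong)
  also have "l1 n 1 \<le> 1"
    by (auto simp: l1_def if_distrib if_distribR cong: if_cong)
  finally show ?thesis by simp
qed

lemma one_minus_exp_bounds:
  assumes "n \<ge> 1"
  shows "1 / (2 * real n) \<le> 1 - exp (- 1 / real n)" "1 - exp (- 1 / real n) \<le> 1 / real n"
proof -
  let ?t = "1 / real n"
  have t: "0 < ?t" "?t \<le> 1" using assms by auto
  show "1 - exp (- 1 / real n) \<le> ?t" using exp_ge_add_one_self[of "- ?t"] by simp
  have "exp (- ?t) = 1 / exp ?t" by (simp add: exp_minus field_simps)
  also have "\<dots> \<le> 1 / (1 + ?t)"
    using exp_ge_add_one_self[of ?t] t by (intro divide_left_mono) (auto simp: add_pos_pos)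
  also have "\<dots> \<le> 1 - ?t / 2"
    using t by (simp add: field_simps)
  finally show "1 / (2 * real n) \<le> 1 - exp (- 1 / real n)" by simp
qed

subsection \<open>Differences of binomial coefficients\<close>

text \<open>The coefficient of z^m in (z^k - 1) (1-z)^(-t).\<close>

definition bdiff :: "real \<Rightarrow> nat \<Rightarrow> nat \<Rightarrow> real" where
  "bdiff t k m = (if k \<le> m then efps (\<lambda>_. t) $ (m - k) else 0) - efps (\<lambda>_. t) $ m"

lemma efps_const_decreasing:
  assumes "0 < t" "t \<le> 1" "m \<le> n"
  shows "efps (\<lambda>_. t) $ n \<le> efps (\<lambda>_. t) $ m"
proof (rule decseqD[OF _ assms(3)], rule decseq_SucI)
  fix n
  have nn: "efps (\<lambda>_. t) $ n \<ge> 0" by (rule efps_nonneg) (use assms in auto)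
  have "real (Suc n) * efps (\<lambda>_. t) $ Suc n \<le> real (Suc n) * efps (\<lambda>_. t) $ n"
    unfolding efps_const_Suc using nn assms by (intro mult_right_mono) auto
  then show "efps (\<lambda>_. t) $ Suc n \<le> efps (\<lambda>_. t) $ n" by simp
qed

text \<open>These are coefficients of (1-z)^t: the first is -t, and each later one arises from its
  predecessor by a factor (k-t)/(k+1) >= 0.\<close>

lemma efps_const_neg_nonpos:
  assumes "0 < t" "t \<le> 1" "k \<ge> 1"
  shows "efps (\<lambda>_. - t) $ k \<le> 0"
  using assms(3)
proof (induction k rule: dec_induct)
  case base
  show ?case using efps_const_Suc[of 0 "-t"] assms by simp
next
  case (step k)
  have "real (Suc k) * efps (\<lambda>_. - t) $ Suc k \<le> 0"
    unfolding efps_const_Suc using step assms by (intro mult_nonneg_nonpos) auto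
  then show ?case by (simp add: mult_le_0_iff)
qed

text \<open>For the coefficients b of (1-z)^t the recurrence reads n b(n) = -t (SUM k<n. b(k)), so
  the sign of b(n) decides that of the partial sum.\<close>

lemma efps_const_neg_sum_nonneg:
  assumes "0 < t" "t \<le> 1"
  shows "0 \<le> (\<Sum>k<n. efps (\<lambda>_. - t) $ k)"
proof (cases "n = 0")
  case False
  have "t * (\<Sum>k<n. efps (\<lambda>_. - t) $ k) = - (real n * efps (\<lambda>_. - t) $ n)"
    using False by (simp add: efps_rec sum_distrib_left sum_negf)
  also have "\<dots> \<ge> 0"
    using efps_const_neg_nonpos[of t n] assms False by (simp add: mult_nonneg_nonpos)
  finally show ?thesis using assms by (simp add: zero_le_mult_iff)
qed auto

text \<open>Comparison with the value (1-y)^(-t) at y = exp (-1/j), where 1/(1-y) <= 2j; the factor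
  2 absorbs 2^t.\<close>

lemma efps_const_sum_le:
  assumes "0 < t" "t \<le> 1" "j \<ge> 1"
  shows "(\<Sum>m<j. efps (\<lambda>_. t) $ m) \<le> 2 * exp 1 * real j powr t"
proof -
  let ?y = "exp (- 1 / real j)"
  have y: "1 / (2 * real j) \<le> 1 - ?y" using one_minus_exp_bounds[of j] assms by auto
  have "gen_fun (\<lambda>_. t) ?y = (1 / (1 - ?y)) powr t"
    using assms by (subst gen_fun_const) (auto simp: powr_minus_divide powr_divide)
  also have "\<dots> \<le> (2 * real j) powr t"
  proof (rule powr_mono2)
    show "1 / (1 - ?y) \<le> 2 * real j"
      using y assms by (simp add: field_simps)
  qed (use assms in auto)
  also have "\<dots> = 2 powr t * real j powr t" by (simp add: powr_mult)
  also have "\<dots> \<le> 2 powr 1 * real j powr t"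
    using assms by (intro mult_right_mono powr_mono) auto
  finally have g: "gen_fun (\<lambda>_. t) ?y \<le> 2 * real j powr t" by simp
  have "(\<Sum>m<j. efps (\<lambda>_. t) $ m) \<le> (\<Sum>m\<le>j. efps (\<lambda>_. t) $ m)"
    by (rule sum_mono2) (use assms in \<open>auto intro: efps_nonneg\<close>)
  also have "\<dots> \<le> exp 1 * gen_fun (\<lambda>_. t) ?y"
    by (rule efps_sum_le[where K = t]) (use assms in auto)
  also have "\<dots> \<le> exp 1 * (2 * real j powr t)"
    using g by (rule mult_left_mono) simp
  finally show ?thesis by (simp add: mult_ac)
qed

lemma bdiff_0 [simp]: "bdiff t 0 m = 0"
  by (simp add: bdiff_def)

lemma bdiff_nonneg: "0 < t \<Longrightarrow> t \<le> 1 \<Longrightarrow> k \<le> m \<Longrightarrow> bdiff t k m \<ge> 0"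
  using efps_const_decreasing[of t "m - k" m] by (simp add: bdiff_def)

lemma bdiff_nonpos: "0 < t \<Longrightarrow> m < k \<Longrightarrow> bdiff t k m \<le> 0"
  using efps_nonneg[of "\<lambda>_. t" m] by (simp add: bdiff_def)

text \<open>A partial sum of the shifted series is a shorter partial sum of the same nonnegative
  coefficients.\<close>

lemma bdiff_sum_nonpos:
  assumes "0 < t" "t \<le> 1"
  shows "(\<Sum>m\<le>n. bdiff t k m) \<le> 0"
proof -
  let ?c = "\<lambda>m. efps (\<lambda>_. t) $ m"
  have "(\<Sum>m\<le>n. if k \<le> m then ?c (m - k) else 0) = (if k \<le> n then \<Sum>i\<le>n-k. ?c i else 0)"
  proof (induction n)
    case (Suc n)
    consider "k \<le> n" | "k = Suc n" | "k > Suc n" by linarith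
    then show ?case using Suc by cases (auto simp: Suc_diff_le)
  qed auto
  also have "\<dots> \<le> (\<Sum>m\<le>n. ?c m)"
    using assms by (auto intro!: sum_nonneg sum_mono2 efps_nonneg)
  finally show ?thesis by (simp add: bdiff_def sum_subtractf)
qed

text \<open>Negative entries occur only for m < k, where they are -c(m). As the total is at most 0,
  the absolute sum is at most twice the negative part, which gives a bound uniform in n.\<close>

lemma bdiff_abs_sum:
  assumes "0 < t" "t \<le> 1" "k \<ge> 1"
  shows "(\<Sum>m\<le>n. \<bar>bdiff t k m\<bar>) \<le> 4 * exp 1 * real k powr t"
proof -
  let ?c = "\<lambda>m. efps (\<lambda>_. t) $ m"
  have c: "?c m \<ge> 0" for m using assms by (auto intro: efps_nonneg)
  have "\<bar>bdiff t k m\<bar> = bdiff t k m + 2 * (if m < k then ?c m else 0)" for m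
    using bdiff_nonneg[of t k m] bdiff_nonpos[of t m k] assms c[of m] by (auto simp: bdiff_def)
  then have "(\<Sum>m\<le>n. \<bar>bdiff t k m\<bar>)
      = (\<Sum>m\<le>n. bdiff t k m) + 2 * (\<Sum>m\<le>n. if m < k then ?c m else 0)"
    by (simp add: sum.distrib sum_distrib_left)
  also have "(\<Sum>m\<le>n. if m < k then ?c m else 0) = (\<Sum>m\<in>{..n} \<inter> {..<k}. ?c m)"
    by (subst sum.inter_restrict) auto
  also have "\<dots> \<le> (\<Sum>m<k. ?c m)"
    by (rule sum_mono2) (auto simp: c)
  also have "\<dots> \<le> 2 * exp 1 * real k powr t"
    by (rule efps_const_sum_le) (use assms in auto)
  finally show ?thesis using bdiff_sum_nonpos[OF assms(1,2), of k n] by simp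
qed

lemma l1_X_power_minus_1_efps:
  assumes "0 < t" "t \<le> 1" "j \<ge> 1"
  shows "l1 n ((fps_X ^ j - 1) * efps (\<lambda>_. t)) \<le> 4 * exp 1 * real j powr t"
proof -
  have "((fps_X ^ j - 1) * efps (\<lambda>_. t)) $ m = bdiff t j m" for m
    by (simp add: left_diff_distrib fps_X_power_mult_nth bdiff_def)
  then show ?thesis using bdiff_abs_sum[OF assms, of n] by (simp add: l1_def)
qed

text \<open>With U(z) = SUM u(k) z^k, the series (U(xz) - U(x)) (1-z)^(-t) is the combination of the
  (z^k - 1) (1-z)^(-t) with weights u(k) x^k. It is used for U = (1-z)^t, where signs decide, and
  for U = W, where absolute values suffice.\<close>

lemma sums_bdiff:
  assumes "(\<lambda>k. u k * x ^ k) sums U"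
  shows "(\<lambda>k. u k * x ^ k * bdiff t k m) sums
    ((Abs_fps (\<lambda>k. x ^ k * u k) * efps (\<lambda>_. t) - fps_const U * efps (\<lambda>_. t)) $ m)"
proof -
  let ?c = "\<lambda>m. efps (\<lambda>_. t) $ m"
  have "(\<lambda>k. if k \<in> {0..m} then u k * x ^ k * ?c (m - k) else 0) sums
      (\<Sum>k=0..m. u k * x ^ k * ?c (m - k))"
    by (rule sums_If_finite_set) auto
  from sums_diff[OF this sums_mult2[OF assms, of "?c m"]]
  have "(\<lambda>k. u k * x ^ k * bdiff t k m) sums
      ((\<Sum>k=0..m. u k * x ^ k * ?c (m - k)) - U * ?c m)"
    by (rule back_subst[of "\<lambda>f. f sums _"]) (auto simp: bdiff_def algebra_simps fun_eq_iff)
  then show ?thesis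
    unfolding fps_sub_nth fps_mult_left_const_nth fps_mult_nth[of "Abs_fps _"]
    by (simp add: mult_ac)
qed

text \<open>
  The series is (1-z)^(-t) ((1-xz)^t - (1-x)^t).  All its coefficients after the constant one
  are nonpositive while its partial sums are nonnegative, so the absolute sum is at most twice
  the constant coefficient.
\<close>

lemma l1_binomial_remainder:
  assumes t: "0 < t" "t \<le> 1" and x: "0 \<le> x" "x < 1"
  shows "l1 n (efps (\<lambda>i. - t * x ^ i) * efps (\<lambda>_. t)
      - fps_const ((1 - x) powr t) * efps (\<lambda>_. t)) \<le> 2"
proof -
  let ?b = "\<lambda>k. efps (\<lambda>_. - t) $ k" and ?U = "(1 - x) powr t"
  let ?R = "\<lambda>m. (efps (\<lambda>i. - t * x ^ i) * efps (\<lambda>_. t) - fps_const ?U * efps (\<lambda>_. t)) $ m"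
  have b_sums: "(\<lambda>k. ?b k * x ^ k) sums ?U"
    using efps_sums[of "\<lambda>_. - t" t x] gen_fun_const[of x "- t"] t x by auto
  have scale: "efps (\<lambda>i. - t * x ^ i) = Abs_fps (\<lambda>k. x ^ k * ?b k)"
    using efps_scale[of "\<lambda>_. - t" x] by (simp add: fps_eq_iff)
  have R: "(\<lambda>k. ?b k * x ^ k * bdiff t k m) sums ?R m" for m
    unfolding scale by (rule sums_bdiff[OF b_sums])
  have b_neg: "?b k \<le> 0" if "k \<noteq> 0" for k
    using efps_const_neg_nonpos[of t k] t that by auto
  have R_neg: "?R m \<le> 0" if "m \<ge> 1" for m
  proof (rule LIMSEQ_le_const2)
    show "(\<lambda>N. \<Sum>k<N. ?b k * x ^ k * bdiff t k m) \<longlonglongrightarrow> ?R m"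
      using R[of m] by (simp only: sums_def)
    show "\<exists>N0. \<forall>N\<ge>N0. (\<Sum>k<N. ?b k * x ^ k * bdiff t k m) \<le> 0"
    proof (intro exI[of _ "Suc m"] allI impI)
      fix N assume N: "Suc m \<le> N"
      \<comment> \<open>The product of \<open>?b k\<close> and \<open>bdiff t k m\<close> is
        nonpositive for 0 < k <= m and nonnegative for k > m, so replacing x^k by x^m can only
        increase each term; the term k = 0 vanishes. What remains is x^m times a coefficient of
        (1-z)^t (1-z)^(-t) = 1, minus a nonnegative product. N > m makes that convolution
        complete.\<close>
      have "(\<Sum>k<N. ?b k * x ^ k * bdiff t k m) \<le> (\<Sum>k<N. ?b k * x ^ m * bdiff t k m)"
      proof (rule sum_mono)
        fix k
        consider "k = 0" | "k \<noteq> 0" "k \<le> m" | "k \<noteq> 0" "m < k" by linarith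
        then show "?b k * x ^ k * bdiff t k m \<le> ?b k * x ^ m * bdiff t k m"
        proof cases
          case 2
          then have "x ^ m \<le> x ^ k" using x by (intro power_decreasing) auto
          moreover have "?b k * bdiff t k m \<le> 0"
            using b_neg[of k] bdiff_nonneg[of t k m] 2 t by (intro mult_nonpos_nonneg) auto
          ultimately have "(?b k * bdiff t k m) * x ^ k \<le> (?b k * bdiff t k m) * x ^ m"
            by (rule mult_left_mono_neg)
          then show ?thesis by (simp add: mult_ac)
        next
          case 3
          then have "x ^ k \<le> x ^ m" using x by (intro power_decreasing) auto
          moreover have "0 \<le> ?b k * bdiff t k m"
            using b_neg[of k] bdiff_nonpos[of t m k] 3 t by (intro mult_nonpos_nonpos) auto
          ultimately have "(?b k * bdiff t k m) * x ^ k \<le> (?b k * bdiff t k m) * x ^ m"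
            by (rule mult_left_mono)
          then show ?thesis by (simp add: mult_ac)
        qed auto
      qed
      also have "\<dots> = x ^ m * (\<Sum>k<N. ?b k * bdiff t k m)"
        by (simp add: sum_distrib_left mult_ac)
      also have "(\<Sum>k<N. ?b k * bdiff t k m)
          = (\<Sum>k<N. if k \<le> m then ?b k * efps (\<lambda>_. t) $ (m - k) else 0)
            - (\<Sum>k<N. ?b k) * efps (\<lambda>_. t) $ m"
        unfolding sum_distrib_right sum_subtractf[symmetric]
        by (rule sum.cong[OF refl]) (simp add: bdiff_def right_diff_distrib)
      also have "(\<Sum>k<N. if k \<le> m then ?b k * efps (\<lambda>_. t) $ (m - k) else 0)
          = (\<Sum>k\<in>{0..m}. ?b k * efps (\<lambda>_. t) $ (m - k))"
        using N by (intro sum.mono_neutral_cong_right) auto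
      also have "\<dots> = (efps (\<lambda>_. - t) * efps (\<lambda>_. t)) $ m"
        by (simp add: fps_mult_nth)
      also have "efps (\<lambda>_. - t) * efps (\<lambda>_. t) = 1"
        using efps_uminus[of "\<lambda>_. t"] by (simp add: mult.commute)
      also have "x ^ m * ((1 :: real fps) $ m - (\<Sum>k<N. ?b k) * efps (\<lambda>_. t) $ m) \<le> 0"
        using that x t efps_const_neg_sum_nonneg[of t N] efps_nonneg[of "\<lambda>_. t" m]
        by (intro mult_nonneg_nonpos) auto
      finally show "(\<Sum>k<N. ?b k * x ^ k * bdiff t k m) \<le> 0" .
    qed
  qed
  have total: "(\<lambda>k. \<Sum>m\<le>n. ?b k * x ^ k * bdiff t k m) sums (\<Sum>m\<le>n. ?R m)"
    by (rule sums_sum) (rule R)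
  \<comment> \<open>Summing over m first, each k > 0 contributes a product of two nonpositive
    factors.\<close>
  have terms: "0 \<le> (\<Sum>m\<le>n. ?b k * x ^ k * bdiff t k m)" for k
  proof (cases "k = 0")
    case False
    then have "0 \<le> ?b k * x ^ k * (\<Sum>m\<le>n. bdiff t k m)"
      using b_neg[of k] bdiff_sum_nonpos[of t k n] x t
      by (intro mult_nonpos_nonpos mult_nonpos_nonneg) auto
    then show ?thesis by (simp add: sum_distrib_left)
  qed auto
  have sum_nonneg: "0 \<le> (\<Sum>m\<le>n. ?R m)"
    by (rule sums_le[OF terms sums_zero total])
  define r where "r m = ?R m" for m
  define U where "U = ?U"
  have U: "0 \<le> U" "U \<le> 1" using x t powr_mono2[of t "1 - x" 1] by (auto simp: U_def)
  have r0: "r 0 = 1 - U" by (simp add: r_def U_def fps_mult_nth)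
  have r_neg: "r m \<le> 0" if "m \<ge> 1" for m using R_neg[OF that] by (simp only: r_def)
  have r_sum: "0 \<le> (\<Sum>m\<le>n. r m)" using sum_nonneg by (simp only: r_def)
  have "\<bar>r m\<bar> = (if m = 0 then 2 * r 0 else 0) - r m" for m
    using r_neg[of m] U r0 by (cases "m = 0") auto
  then have "(\<Sum>m\<le>n. \<bar>r m\<bar>) = 2 * r 0 - (\<Sum>m\<le>n. r m)"
    by (simp add: sum_subtractf)
  also have "\<dots> \<le> 2" using r_sum r0 U by linarith
  finally show ?thesis by (simp only: l1_def r_def)
qed

text \<open>The binomial expansion of (x+h)^k contains k h x^(k-1), and x <= 1 permits the exponent
  k.\<close>

lemma power_scaled_le:
  fixes x h :: real
  assumes "0 \<le> x" "x \<le> 1" "0 \<le> h"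
  shows "real k * h * x ^ k \<le> (x + h) ^ k"
proof (induction k)
  case (Suc k)
  have "real (Suc k) * h * x ^ Suc k = x * (real k * h * x ^ k) + h * x ^ Suc k"
    by (simp add: algebra_simps)
  also have "\<dots> \<le> x * (x + h) ^ k + h * (x + h) ^ k"
  proof (intro add_mono mult_left_mono Suc)
    have "x ^ Suc k \<le> x ^ k" using assms by (intro power_decreasing) auto
    also have "\<dots> \<le> (x + h) ^ k" using assms by (intro power_mono) auto
    finally show "x ^ Suc k \<le> (x + h) ^ k" .
  qed (use assms in auto)
  finally show ?case by (simp add: algebra_simps)
qed auto

text \<open>With s = k (1-x), s^t <= 1 + s, and s x^k is absorbed by \<open>power_scaled_le\<close>
  with h = (1-x)/2. Against the coefficients of W the right side sums to values of W at x and
  (1+x)/2, so the factor k^t from \<open>bdiff_abs_sum\<close> disappears.\<close>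

lemma powr_power_le:
  fixes x t :: real
  assumes "0 < t" "t \<le> 1" "0 \<le> x" "x < 1"
  shows "real k powr t * x ^ k \<le> (1 - x) powr (- t) * (x ^ k + 2 * ((1 + x) / 2) ^ k)"
proof -
  let ?s = "real k * (1 - x)"
  have s: "?s \<ge> 0" using assms by simp
  have "?s powr t \<le> 1 + ?s"
  proof (cases "?s \<le> 1")
    case True
    then have "?s powr t \<le> 1 powr t" using s assms by (intro powr_mono2) auto
    then show ?thesis using s by simp
  next
    case False
    then have "?s powr t \<le> ?s powr 1" using assms by (intro powr_mono) auto
    then show ?thesis using False by simp
  qed
  then have "?s powr t * x ^ k \<le> (1 + ?s) * x ^ k"
    using assms by (intro mult_right_mono) auto
  also have "\<dots> \<le> x ^ k + 2 * ((1 + x) / 2) ^ k"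
    using power_scaled_le[of x "(1 - x) / 2" k] assms
    by (simp add: field_simps)
  finally have "(1 - x) powr (- t) * (?s powr t * x ^ k)
      \<le> (1 - x) powr (- t) * (x ^ k + 2 * ((1 + x) / 2) ^ k)"
    by (rule mult_left_mono) simp
  moreover have "(1 - x) powr (- t) * (?s powr t * x ^ k) = real k powr t * x ^ k"
  proof -
    have "?s powr t = real k powr t * (1 - x) powr t"
      by (rule powr_mult)
    moreover have "(1 - x) powr (- t) * (1 - x) powr t = 1"
      using assms by (simp add: powr_add[symmetric])
    ultimately show ?thesis by (simp add: mult_ac)
  qed
  ultimately show ?thesis by simp
qed

text \<open>The series is (1-z)^(-t) (W(xz) - W(x)) for W = gen_fun e.\<close>

lemma l1_smoothed_remainder:
  assumes e: "\<And>i. i \<ge> 1 \<Longrightarrow> 0 \<le> e i" "\<And>i. i \<ge> 1 \<Longrightarrow> e i \<le> real K"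
    and t: "0 < t" "t \<le> 1" and x: "0 \<le> x" "x < 1"
  shows "l1 n (efps (\<lambda>i. e i * x ^ i) * efps (\<lambda>_. t) - fps_const (gen_fun e x) * efps (\<lambda>_. t))
    \<le> 4 * exp 1 * (1 + 2 * 2 ^ K) * (1 - x) powr (- t) * gen_fun e x"
proof -
  let ?w = "\<lambda>k. efps e $ k" and ?x = "(1 + x) / 2"
  let ?T = "\<lambda>m. (efps (\<lambda>i. e i * x ^ i) * efps (\<lambda>_. t) - fps_const (gen_fun e x) * efps (\<lambda>_. t)) $ m"
  define A where "A = 4 * exp 1 * (1 - x) powr (- t)"
  have A: "A \<ge> 0" by (simp add: A_def)
  have eK: "\<bar>e i\<bar> \<le> real K" if "i \<ge> 1" for i using e[OF that] by linarith
  have w: "?w k \<ge> 0" for k by (rule efps_nonneg) (use e in auto)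
  have w_sums: "(\<lambda>k. ?w k * y ^ k) sums gen_fun e y" if "\<bar>y\<bar> < 1" for y
    by (rule efps_sums[of e "real K"]) (use eK that in auto)
  have scale: "efps (\<lambda>i. e i * x ^ i) = Abs_fps (\<lambda>k. x ^ k * ?w k)"
    using efps_scale[of e x] by (simp add: fps_eq_iff)
  have T: "(\<lambda>k. ?w k * x ^ k * bdiff t k m) sums ?T m" for m
    unfolding scale by (rule sums_bdiff[OF w_sums]) (use x in auto)
  \<comment> \<open>Fixed signs make the absolute sum over m linear in the coefficients, so that it
    can be taken inside the series over k.\<close>
  have *: "(\<lambda>k. \<Sum>m\<le>n. sgn (?T m) * (?w k * x ^ k * bdiff t k m)) sums (\<Sum>m\<le>n. sgn (?T m) * ?T m)"
    by (intro sums_sum sums_mult T)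
  have **: "(\<lambda>k. A * (?w k * x ^ k + 2 * (?w k * ?x ^ k))) sums (A * (gen_fun e x + 2 * gen_fun e ?x))"
    by (intro sums_mult sums_add w_sums) (use x in auto)
  have "(\<Sum>m\<le>n. sgn (?T m) * (?w k * x ^ k * bdiff t k m)) \<le> A * (?w k * x ^ k + 2 * (?w k * ?x ^ k))" for k
  proof -
    have "(\<Sum>m\<le>n. sgn (?T m) * (?w k * x ^ k * bdiff t k m)) \<le> (\<Sum>m\<le>n. ?w k * x ^ k * \<bar>bdiff t k m\<bar>)"
    proof (rule sum_mono)
      fix m
      have "sgn (?T m) * bdiff t k m \<le> \<bar>bdiff t k m\<bar>"
        by (auto simp: sgn_if)
      then have "(?w k * x ^ k) * (sgn (?T m) * bdiff t k m) \<le> (?w k * x ^ k) * \<bar>bdiff t k m\<bar>"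
        using w[of k] x by (intro mult_left_mono) auto
      then show "sgn (?T m) * (?w k * x ^ k * bdiff t k m) \<le> ?w k * x ^ k * \<bar>bdiff t k m\<bar>"
        by (simp only: mult_ac)
    qed
    also have "\<dots> = (?w k * x ^ k) * (\<Sum>m\<le>n. \<bar>bdiff t k m\<bar>)"
      by (simp add: sum_distrib_left)
    also have "\<dots> \<le> (?w k * x ^ k) * (4 * exp 1 * real k powr t)"
    proof (rule mult_left_mono)
      show "(\<Sum>m\<le>n. \<bar>bdiff t k m\<bar>) \<le> 4 * exp 1 * real k powr t"
        using bdiff_abs_sum[OF t, of k n] by (cases "k = 0") auto
    qed (use w[of k] x in auto)
    also have "\<dots> = ?w k * (4 * exp 1) * (real k powr t * x ^ k)" by simp
    also have "\<dots> \<le> ?w k * (4 * exp 1) * ((1 - x) powr (- t) * (x ^ k + 2 * ?x ^ k))"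
      by (rule mult_left_mono[OF powr_power_le]) (use t x w[of k] in auto)
    also have "\<dots> = A * (?w k * x ^ k + 2 * (?w k * ?x ^ k))"
      by (simp add: A_def algebra_simps)
    finally show ?thesis .
  qed
  from sums_le[OF this * **]
  have "(\<Sum>m\<le>n. \<bar>?T m\<bar>) \<le> A * (gen_fun e x + 2 * gen_fun e ?x)"
    by (simp only: abs_sgn mult.commute)
  also have "\<dots> \<le> A * (gen_fun e x + 2 * (gen_fun e x * 2 ^ K))"
  proof -
    \<comment> \<open>Passing to the midpoint of x and 1 halves the distance to 1 and so costs a
      factor 2^K.\<close>
    have "gen_fun e ?x \<le> gen_fun e x * ((1 - x) / (1 - ?x)) ^ K"
      by (rule gen_fun_growth) (use e x in auto)
    also have "(1 - x) / (1 - ?x) = 2" using x by (simp add: field_simps)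
    finally show ?thesis using A by (intro mult_left_mono) auto
  qed
  also have "\<dots> = 4 * exp 1 * (1 + 2 * 2 ^ K) * (1 - x) powr (- t) * gen_fun e x"
    by (simp add: A_def algebra_simps)
  finally show ?thesis unfolding l1_def .
qed

section \<open>The quotient p(z)/p(xz) and its approximation by p(z)/p(x)\<close>

lemma abs_damped_le:
  fixes d :: "nat \<Rightarrow> real"
  assumes "\<And>i. i \<ge> 1 \<Longrightarrow> 0 \<le> d i" "\<And>i. i \<ge> 1 \<Longrightarrow> d i \<le> K" "0 \<le> x" "x \<le> 1" "i \<ge> 1"
  shows "0 \<le> d i * (1 - x ^ i)" "d i * (1 - x ^ i) \<le> K" "\<bar>d i * x ^ i\<bar> \<le> K"
proof -
  have x: "0 \<le> x ^ i" "x ^ i \<le> 1" using assms by (auto intro: power_le_one)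
  have d: "0 \<le> d i" "d i \<le> K" using assms by auto
  show "0 \<le> d i * (1 - x ^ i)" using x d by simp
  show "d i * (1 - x ^ i) \<le> K" using mult_left_le[of "1 - x ^ i" "d i"] x d by simp
  show "\<bar>d i * x ^ i\<bar> \<le> K" using mult_left_le[of "x ^ i" "d i"] x d by simp
qed

text \<open>The weights d(i) (1 - x^i) are those of p(z)/p(xz).\<close>

lemma damped_sum_le:
  assumes d: "\<And>i. i \<ge> 1 \<Longrightarrow> 0 \<le> d i" "\<And>i. i \<ge> 1 \<Longrightarrow> d i \<le> K"
    and x: "0 \<le> x" "x \<le> (1::real)" and n: "n \<ge> 1"
  defines "Y \<equiv> exp (- 1 / real n)"
  shows "(\<Sum>k\<le>n. efps (\<lambda>i. d i * (1 - x ^ i)) $ k) \<le> exp 1 * (gen_fun d Y / gen_fun d (x * Y))"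
proof -
  have Y: "0 < Y" "Y < 1" using n by (auto simp: Y_def)
  note b = abs_damped_le[of d K, OF d x]
  have "(\<Sum>k\<le>n. efps (\<lambda>i. d i * (1 - x ^ i)) $ k) \<le> exp 1 * gen_fun (\<lambda>i. d i * (1 - x ^ i)) Y"
    unfolding Y_def by (rule efps_sum_le[where K = K]) (use b n in auto)
  moreover have "gen_fun (\<lambda>i. d i * (1 - x ^ i) + d i * x ^ i) Y
      = gen_fun (\<lambda>i. d i * (1 - x ^ i)) Y * gen_fun (\<lambda>i. d i * x ^ i) Y"
    by (rule gen_fun_add[where K = K and L = K]) (use b Y in auto)
  then have "gen_fun d Y = gen_fun (\<lambda>i. d i * (1 - x ^ i)) Y * gen_fun d (x * Y)"
    by (simp add: gen_fun_scale algebra_simps)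
  ultimately show ?thesis using gen_fun_pos[of d "x * Y"] by (simp add: field_simps)
qed

lemma gen_fun_split:
  assumes "\<And>i. i \<ge> 1 \<Longrightarrow> \<bar>d i\<bar> \<le> K" "\<bar>x\<bar> < (1::real)"
  shows "gen_fun d x = gen_fun (\<lambda>i. d i - t) x * (1 - x) powr (- t)"
proof -
  have "gen_fun (\<lambda>i. (d i - t) + t) x = gen_fun (\<lambda>i. d i - t) x * gen_fun (\<lambda>_. t) x"
  proof (rule gen_fun_add)
    fix i :: nat assume "i \<ge> 1"
    then show "\<bar>d i - t\<bar> \<le> K + \<bar>t\<bar>" using assms(1)[of i] by linarith
  qed (use assms in auto)
  then show ?thesis using assms by (simp add: gen_fun_const)
qed

text \<open>With c = (1-z)^(-t) and V = W(z)/W(xz), the quotient p(z)/p(xz) is V (1-xz)^t c, and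
  p(z) is V W(xz) c. Freezing xz at x in (1-xz)^t and in W(xz) costs the remainders R and T. Only
  (1-x)^t (z^j - 1) c has a norm growing with j, namely as (j(1-x))^t.\<close>

lemma l1_damped_approx:
  assumes t: "0 < t" "t \<le> 1" and d: "\<And>i. i \<ge> 1 \<Longrightarrow> t \<le> d i" "\<And>i. i \<ge> 1 \<Longrightarrow> d i \<le> real K"
    and x: "0 \<le> x" "x < 1" and j: "j \<ge> 1"
  shows "l1 n (fps_X ^ j * efps (\<lambda>i. d i * (1 - x ^ i)) - fps_const (1 / gen_fun d x) * efps d)
    \<le> (\<Sum>k\<le>n. efps (\<lambda>i. (d i - t) * (1 - x ^ i)) $ k)
       * (8 * exp 1 * (2 + 2 * 2 ^ K) * (1 + (real j * (1 - x)) powr t))"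
proof -
  define e where "e i = d i - t" for i
  have e: "0 \<le> e i" "e i \<le> real K" if "i \<ge> 1" for i
    using d(1)[OF that] d(2)[OF that] t by (auto simp: e_def)
  define p W where "p = gen_fun d x" and "W = gen_fun e x"
  define c where "c = efps (\<lambda>_. t)"
  define a where "a = (1 - x) powr t"
  define V where "V = efps (\<lambda>i. e i * (1 - x ^ i))"
  define B where "B = efps (\<lambda>i. - t * x ^ i)"
  define S where "S = efps (\<lambda>i. e i * x ^ i)"
  have a: "0 < a" using x by (simp add: a_def)
  have W: "W > 0" unfolding W_def by (rule gen_fun_pos)
  have p_W: "p = W / a"
  proof -
    have "p = W * (1 - x) powr (- t)"
      unfolding p_def W_def e_def
    proof (rule gen_fun_split)
      show "\<bar>d i\<bar> \<le> real K" if "i \<ge> 1" for i using d(1)[OF that] d(2)[OF that] t by linarith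
    qed (use x in auto)
    then show ?thesis by (simp add: a_def powr_minus field_simps)
  qed
  define R where "R = B * c - fps_const a * c"
  define T where "T = S * c - fps_const W * c"
  have q: "efps (\<lambda>i. d i * (1 - x ^ i)) = V * (B * c)"
    unfolding V_def B_def c_def efps_add[symmetric] by (simp add: e_def algebra_simps)
  have efps_d: "efps d = V * (S * c)"
    unfolding V_def S_def c_def efps_add[symmetric] by (simp add: e_def algebra_simps)
  \<comment> \<open>After freezing, the multiples of c left over from R and T / p cancel, because
    W(x)/p(x) = (1-x)^t.\<close>
  have "fps_X ^ j * efps (\<lambda>i. d i * (1 - x ^ i)) - fps_const (1 / p) * efps d
      = V * (((fps_X ^ j - 1) * R + fps_const a * ((fps_X ^ j - 1) * c)) + (R - fps_const (1 / p) * T))"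
  proof -
    have "fps_const (1 / p) * fps_const W = fps_const a"
      using W a by (simp add: p_W)
    then have *: "fps_const (1 / p) * (fps_const W * c) = fps_const a * c"
      by (metis mult.assoc)
    show ?thesis
      unfolding q efps_d R_def T_def right_diff_distrib[of "fps_const (1 / p)"] *
      by (simp add: algebra_simps)
  qed
  then have "l1 n (fps_X ^ j * efps (\<lambda>i. d i * (1 - x ^ i)) - fps_const (1 / p) * efps d)
    \<le> l1 n V * l1 n (((fps_X ^ j - 1) * R + fps_const a * ((fps_X ^ j - 1) * c)) + (R - fps_const (1 / p) * T))"
    by (simp only: l1_mult)
  also have "\<dots> \<le> l1 n V * (8 * exp 1 * (2 + 2 * 2 ^ K) * (1 + (real j * (1 - x)) powr t))"
  proof (rule mult_left_mono[OF _ l1_nonneg])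
    have R: "l1 n R \<le> 2"
      unfolding R_def B_def c_def a_def using l1_binomial_remainder[OF t x] by simp
    have T: "l1 n T \<le> 4 * exp 1 * (1 + 2 * 2 ^ K) * p"
    proof -
      have "l1 n T \<le> 4 * exp 1 * (1 + 2 * 2 ^ K) * (1 - x) powr (- t) * W"
        unfolding T_def S_def c_def W_def by (rule l1_smoothed_remainder) (use e t x in auto)
      also have "\<dots> = 4 * exp 1 * (1 + 2 * 2 ^ K) * p"
        by (simp add: p_W a_def powr_minus field_simps)
      finally show ?thesis .
    qed
    have "l1 n ((fps_X ^ j - 1) * R) \<le> l1 n (fps_X ^ j - 1) * l1 n R" by (rule l1_mult)
    also have "\<dots> \<le> 2 * 2" by (intro mult_mono R l1_X_power_minus_1) (auto simp: l1_nonneg)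
    finally have 1: "l1 n ((fps_X ^ j - 1) * R) \<le> 4" by simp
    have "l1 n (fps_const a * ((fps_X ^ j - 1) * c)) \<le> a * (4 * exp 1 * real j powr t)"
      unfolding l1_const_mult c_def using a l1_X_power_minus_1_efps[OF t j, of n]
      by (simp add: mult_left_mono)
    also have "\<dots> = 4 * exp 1 * (real j * (1 - x)) powr t"
      by (simp add: a_def powr_mult)
    finally have 2: "l1 n (fps_const a * ((fps_X ^ j - 1) * c)) \<le> 4 * exp 1 * (real j * (1 - x)) powr t" .
    have p: "p > 0" unfolding p_def by (rule gen_fun_pos)
    have "l1 n (fps_const (1 / p) * T) \<le> 1 / p * (4 * exp 1 * (1 + 2 * 2 ^ K) * p)"
      unfolding l1_const_mult using p T by (intro mult_mono) (auto simp: l1_nonneg)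
    then have 3: "l1 n (fps_const (1 / p) * T) \<le> 4 * exp 1 * (1 + 2 * 2 ^ K)"
      using p by simp
    define s where "s = (real j * (1 - x)) powr t"
    have s: "s \<ge> 0" by (simp add: s_def)
    define E where "E = exp (1::real)"
    have E: "E \<ge> 1" by (simp add: E_def)
    have E2: "E * 2 ^ K \<ge> 0" "E * s \<ge> 0" "E * 2 ^ K * s \<ge> 0" using s E by auto
    have "l1 n (((fps_X ^ j - 1) * R + fps_const a * ((fps_X ^ j - 1) * c)) + (R - fps_const (1 / p) * T))
        \<le> (4 + 4 * exp 1 * s) + (2 + 4 * exp 1 * (1 + 2 * 2 ^ K))"
      using 1 2 3 R l1_add[of n "(fps_X ^ j - 1) * R + fps_const a * ((fps_X ^ j - 1) * c)" "R - fps_const (1 / p) * T"]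
        l1_add[of n "(fps_X ^ j - 1) * R" "fps_const a * ((fps_X ^ j - 1) * c)"]
        l1_diff[of n R "fps_const (1 / p) * T"]
      unfolding s_def[symmetric] by linarith
    also have "\<dots> \<le> 8 * exp 1 * (2 + 2 * 2 ^ K) * (1 + s)"
    proof -
      have "(4 + 4 * E * s) + (2 + 4 * E * (1 + 2 * P)) \<le> 8 * E * (2 + 2 * P) * (1 + s)"
        if "E * P \<ge> 0" "E * P * s \<ge> 0" for P
      proof -
        have "8 * E * (2 + 2 * P) * (1 + s) - ((4 + 4 * E * s) + (2 + 4 * E * (1 + 2 * P)))
            = (12 * E - 6) + 12 * (E * s) + 8 * (E * P) + 16 * (E * P * s)"
          by (simp add: algebra_simps)
        also have "\<dots> \<ge> 0" using E E2(2) that by (intro add_nonneg_nonneg) auto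
        finally show ?thesis by simp
      qed
      from this[OF E2(1,3)] show ?thesis unfolding E_def .
    qed
    finally show "l1 n (((fps_X ^ j - 1) * R + fps_const a * ((fps_X ^ j - 1) * c)) + (R - fps_const (1 / p) * T))
      \<le> 8 * exp 1 * (2 + 2 * 2 ^ K) * (1 + (real j * (1 - x)) powr t)" unfolding s_def .
  qed
  also have "l1 n V = (\<Sum>k\<le>n. efps (\<lambda>i. (d i - t) * (1 - x ^ i)) $ k)"
  proof -
    have "V $ k \<ge> 0" for k
      unfolding V_def using abs_damped_le(1)[of e K x] e x by (intro efps_nonneg) auto
    then show ?thesis by (simp add: l1_def V_def e_def)
  qed
  finally show ?thesis unfolding p_def .
qed

subsection \<open>Integrals of reciprocals\<close>

lemma continuous_on_gen_fun:
  assumes "\<And>i. i \<ge> 1 \<Longrightarrow> \<bar>d i\<bar> \<le> K" "A \<subseteq> {-1<..<(1::real)}"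
  shows "continuous_on A (gen_fun d)"
proof -
  have "ereal (norm x) < fps_conv_radius (efps d)" if "x \<in> A" for x
  proof -
    have "\<bar>x\<bar> < 1" using subsetD[OF assms(2) that] by auto
    then show ?thesis using conv_radius_efps(1)[of d K, OF assms(1)]
      by (metis less_ereal.simps(1) one_ereal_def order_less_le_trans real_norm_def)
  qed
  then have "continuous_on A (eval_fps (efps d))"
    by (intro continuous_on_subset[OF continuous_on_eval_fps]) (auto simp: in_eball_iff)
  moreover have "eval_fps (efps d) x = gen_fun d x" if "x \<in> A" for x
    by (rule eval_efps[of d K]) (use assms(1) subsetD[OF assms(2) that] in auto)
  ultimately show ?thesis by (simp cong: continuous_on_cong_simp)
qed

lemma power_le_fact_exp: "a ^ k \<le> fact k * exp a" if "a \<ge> 0" for a :: real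
proof -
  have "(\<Sum>n\<in>{k}. a ^ n /\<^sub>R fact n) \<le> (\<Sum>n. a ^ n /\<^sub>R fact n)"
    by (rule sum_le_suminf) (use that exp_converges[of a] in \<open>auto simp: sums_iff\<close>)
  then have "a ^ k /\<^sub>R fact k \<le> exp a" using exp_converges[of a] by (simp add: sums_iff)
  then show ?thesis by (simp add: field_simps)
qed

text \<open>With s = 1 - x/Z, the power x^(j-1) decays like exp (-js), while the last hypothesis
  lets 1/p(x) grow only polynomially in js. Half of the decay pays for the polynomial, and the other
  half integrates to at most 2Z/j. The uses are Z = Y for j >= n and Z = 1 for an arbitrary
  j.\<close>

lemma power_reciprocal_integral_le:
  assumes d: "\<And>i. i \<ge> 1 \<Longrightarrow> 0 \<le> d i" "\<And>i. i \<ge> 1 \<Longrightarrow> d i \<le> real K"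
    and Y: "0 < Y" "Y < 1" "Y \<le> Z" and j: "j \<ge> 1"
    and le: "\<And>x. 0 \<le> x \<Longrightarrow> x \<le> Y \<Longrightarrow> gen_fun d v \<le> gen_fun d x * (2 + 2 * real j * (1 - x / Z)) ^ K"
  shows "integral {0..Y} (\<lambda>x. x ^ (j - 1) / gen_fun d x)
    \<le> 2 * 4 ^ K * fact K * exp 2 * Z ^ j / (real j * gen_fun d v)"
proof -
  define C where "C = 4 ^ K * fact K * exp 2 * Z ^ (j - 1) / gen_fun d v"
  have Z: "Z > 0" using Y by simp
  have vp: "gen_fun d v > 0" by (rule gen_fun_pos)
  have dK: "\<bar>d i\<bar> \<le> real K" if "i \<ge> 1" for i using d[OF that] by linarith
  have "((\<lambda>x. exp (- real j * (1 - x / Z) / 2)) has_integral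
      (2 * Z / real j * exp (- real j * (1 - Y / Z) / 2) - 2 * Z / real j * exp (- real j * (1 - 0 / Z) / 2))) {0..Y}"
    by (rule fundamental_theorem_of_calculus)
       (use Y Z j in \<open>auto intro!: derivative_eq_intros simp: has_real_derivative_iff_has_vector_derivative[symmetric] field_simps\<close>)
  from has_integral_mult_right[OF this, of C]
  have I: "((\<lambda>x. C * exp (- real j * (1 - x / Z) / 2)) has_integral
      C * (2 * Z / real j * exp (- real j * (1 - Y / Z) / 2) - 2 * Z / real j * exp (- real j * (1 - 0 / Z) / 2))) {0..Y}" .
  have "integral {0..Y} (\<lambda>x. x ^ (j - 1) / gen_fun d x) \<le>
     C * (2 * Z / real j * exp (- real j * (1 - Y / Z) / 2) - 2 * Z / real j * exp (- real j * (1 - 0 / Z) / 2))"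
  proof (rule has_integral_le[OF integrable_integral I])
    have "gen_fun d x \<noteq> 0" for x :: real using gen_fun_pos[of d x] by simp
    then show "(\<lambda>x. x ^ (j - 1) / gen_fun d x) integrable_on {0..Y}"
      by (intro integrable_continuous_interval continuous_intros continuous_on_gen_fun[of d "real K"])
         (use dK Y in auto)
  next
    fix x assume x: "x \<in> {0..Y}"
    define s where "s = 1 - x / Z"
    have s: "0 \<le> s" "s \<le> 1" using x Y Z by (auto simp: s_def)
    have xp: "gen_fun d x > 0" by (rule gen_fun_pos)
    have "x ^ (j - 1) = Z ^ (j - 1) * (1 - s) ^ (j - 1)"
      using Z by (simp add: s_def power_divide)
    also have "(1 - s) ^ (j - 1) \<le> exp (- s) ^ (j - 1)"
      using s exp_ge_add_one_self[of "- s"] by (intro power_mono) auto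
    also have "exp (- s) ^ (j - 1) = exp (s - real j * s)"
      using j by (simp add: exp_of_nat_mult[symmetric] of_nat_diff algebra_simps)
    also have "\<dots> \<le> exp (1 - real j * s)" using s by simp
    finally have 1: "x ^ (j - 1) \<le> Z ^ (j - 1) * exp (1 - real j * s)" using Z by simp
    \<comment> \<open>Scaling by 4 makes the exponential bound grow only like exp (js/2), half the
      available decay.\<close>
    have "(2 + 2 * real j * s) ^ K = 4 ^ K * (1 / 2 + real j * s / 2) ^ K"
      by (simp add: power_mult_distrib[symmetric] algebra_simps)
    also have "\<dots> \<le> 4 ^ K * (fact K * exp (1 / 2 + real j * s / 2))"
      using s by (intro mult_left_mono power_le_fact_exp) auto
    finally have 2: "(2 + 2 * real j * s) ^ K \<le> 4 ^ K * (fact K * exp (1 / 2 + real j * s / 2))" .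
    have "1 / gen_fun d x \<le> (2 + 2 * real j * s) ^ K / gen_fun d v"
      using le[of x] x xp vp by (simp add: s_def field_simps)
    also have "\<dots> \<le> 4 ^ K * (fact K * exp (1 / 2 + real j * s / 2)) / gen_fun d v"
      using 2 vp by (intro divide_right_mono) auto
    finally have 3: "1 / gen_fun d x \<le> 4 ^ K * (fact K * exp (1 / 2 + real j * s / 2)) / gen_fun d v" .
    have "x ^ (j - 1) / gen_fun d x = x ^ (j - 1) * (1 / gen_fun d x)" by simp
    also have "\<dots> \<le> (Z ^ (j - 1) * exp (1 - real j * s)) * (4 ^ K * (fact K * exp (1 / 2 + real j * s / 2)) / gen_fun d v)"
      using x xp Z by (intro mult_mono 1 3) auto
    also have "\<dots> = 4 ^ K * fact K * Z ^ (j - 1) / gen_fun d v * (exp (1 - real j * s) * exp (1 / 2 + real j * s / 2))"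
      by simp
    also have "\<dots> \<le> 4 ^ K * fact K * Z ^ (j - 1) / gen_fun d v * (exp 2 * exp (- real j * s / 2))"
    proof (rule mult_left_mono)
      show "exp (1 - real j * s) * exp (1 / 2 + real j * s / 2) \<le> exp 2 * exp (- real j * s / 2)"
        unfolding exp_add[symmetric] by (simp add: mult.commute)
    qed (use Z vp in auto)
    finally show "x ^ (j - 1) / gen_fun d x \<le> C * exp (- real j * (1 - x / Z) / 2)"
      using Z vp by (simp add: C_def s_def mult_ac)
  qed
  also have "\<dots> \<le> C * (2 * Z / real j)"
  proof (rule mult_left_mono)
    have "2 * Z / real j * exp (- real j * (1 - Y / Z) / 2) \<le> 2 * Z / real j * 1"
      using Y Z j by (intro mult_left_mono) auto
    moreover have "0 \<le> 2 * Z / real j * exp (- real j * (1 - 0 / Z) / 2)" using Z by simp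
    ultimately show "2 * Z / real j * exp (- real j * (1 - Y / Z) / 2)
      - 2 * Z / real j * exp (- real j * (1 - 0 / Z) / 2) \<le> 2 * Z / real j" by simp
  qed (use Z vp in \<open>auto simp: C_def\<close>)
  also have "Z ^ j = Z ^ (j - 1) * Z" using j by (metis Suc_pred' less_eq_Suc_le One_nat_def power_Suc2)
  then have "C * (2 * Z / real j) = 2 * 4 ^ K * fact K * exp 2 * Z ^ j / (real j * gen_fun d v)"
    by (simp add: C_def field_simps)
  finally show ?thesis .
qed

text \<open>The case Z = v = Y. Distances to 1 are compared through 1-x <= (1-Y) + (1-x/Y) and 1 <=
  2j (1-Y), the latter because j >= n.\<close>

lemma reciprocal_integral_far:
  assumes d: "\<And>i. i \<ge> 1 \<Longrightarrow> 0 \<le> d i" "\<And>i. i \<ge> 1 \<Longrightarrow> d i \<le> real K"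
    and n: "1 \<le> n" "n \<le> j"
  defines "Y \<equiv> exp (- 1 / real n)"
  shows "integral {0..Y} (\<lambda>x. x ^ (j - 1) / gen_fun d x)
    \<le> 2 * 4 ^ K * fact K * exp 2 * Y ^ j / (real j * gen_fun d Y)"
proof (rule power_reciprocal_integral_le[OF d])
  show Y: "0 < Y" "Y < 1" using n by (auto simp: Y_def)
  fix x assume x: "0 \<le> x" "x \<le> Y"
  have b: "1 / (2 * real n) \<le> 1 - Y" unfolding Y_def by (rule one_minus_exp_bounds) (use n in auto)
  have s: "0 \<le> 1 - x / Y" using x Y by simp
  have "1 - x = (1 - Y) + Y * (1 - x / Y)" using Y by (simp add: field_simps)
  also have "\<dots> \<le> (1 - Y) + 1 * (1 - x / Y)" using Y s by (intro add_left_mono mult_right_mono) auto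
  also have "\<dots> \<le> (1 - Y) + (2 * real j * (1 - Y)) * (1 - x / Y)"
  proof (intro add_left_mono mult_right_mono s)
    have "1 \<le> 2 * real n * (1 - Y)" using b n by (simp add: field_simps)
    also have "\<dots> \<le> 2 * real j * (1 - Y)" using n Y by (intro mult_right_mono) auto
    finally show "1 \<le> 2 * real j * (1 - Y)" .
  qed
  also have "\<dots> = (1 + 2 * real j * (1 - x / Y)) * (1 - Y)"
  proof -
    have "(1 - Y) + (a * (1 - Y)) * b = (1 + a * b) * (1 - Y)" for a b
      by (simp add: algebra_simps)
    then show ?thesis .
  qed
  finally have "(1 - x) / (1 - Y) \<le> 1 + 2 * real j * (1 - x / Y)"
    using Y by (simp add: pos_divide_le_eq)
  then have "((1 - x) / (1 - Y)) ^ K \<le> (2 + 2 * real j * (1 - x / Y)) ^ K"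
    using x Y by (intro power_mono) auto
  then have "gen_fun d x * ((1 - x) / (1 - Y)) ^ K \<le> gen_fun d x * (2 + 2 * real j * (1 - x / Y)) ^ K"
    using gen_fun_pos[of d x] by (intro mult_left_mono) auto
  moreover have "gen_fun d Y \<le> gen_fun d x * ((1 - x) / (1 - Y)) ^ K"
    by (rule gen_fun_growth) (use d x Y in auto)
  ultimately show "gen_fun d Y \<le> gen_fun d x * (2 + 2 * real j * (1 - x / Y)) ^ K" by linarith
qed (use n in auto)

text \<open>The case Z = 1, v = exp (-1/j), with a bound uniform in Y. Below v the growth bound
  applies; above v, p(v) <= p(x) suffices.\<close>

lemma reciprocal_integral_near:
  assumes d: "\<And>i. i \<ge> 1 \<Longrightarrow> 0 \<le> d i" "\<And>i. i \<ge> 1 \<Longrightarrow> d i \<le> real K"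
    and Y: "0 < Y" "Y < 1" and j: "j \<ge> 1"
  shows "integral {0..Y} (\<lambda>x. x ^ (j - 1) / gen_fun d x)
    \<le> 2 * 4 ^ K * fact K * exp 2 / (real j * gen_fun d (exp (- 1 / real j)))"
proof -
  let ?v = "exp (- 1 / real j)"
  have v: "0 < ?v" "?v < 1" using j by auto
  have "integral {0..Y} (\<lambda>x. x ^ (j - 1) / gen_fun d x)
    \<le> 2 * 4 ^ K * fact K * exp 2 * 1 ^ j / (real j * gen_fun d ?v)"
  proof (rule power_reciprocal_integral_le[OF d])
    fix x assume x: "0 \<le> x" "x \<le> Y"
    have pos: "gen_fun d x > 0" by (rule gen_fun_pos)
    show "gen_fun d ?v \<le> gen_fun d x * (2 + 2 * real j * (1 - x / 1)) ^ K"
    proof (cases "x \<le> ?v")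
      case True
      have b: "1 / (2 * real j) \<le> 1 - ?v" by (rule one_minus_exp_bounds) (use j in auto)
      have "1 \<le> 2 * real j * (1 - ?v)" using b j by (simp add: field_simps)
      then have "1 * (1 - x) \<le> 2 * real j * (1 - ?v) * (1 - x)"
        using x Y by (intro mult_right_mono) auto
      also have "\<dots> \<le> (2 + 2 * real j * (1 - x)) * (1 - ?v)" using v by (simp add: algebra_simps)
      finally have "(1 - x) / (1 - ?v) \<le> 2 + 2 * real j * (1 - x)"
        using v by (simp add: pos_divide_le_eq)
      then have "((1 - x) / (1 - ?v)) ^ K \<le> (2 + 2 * real j * (1 - x / 1)) ^ K"
        using x Y v by (intro power_mono) auto
      then have "gen_fun d x * ((1 - x) / (1 - ?v)) ^ K \<le> gen_fun d x * (2 + 2 * real j * (1 - x / 1)) ^ K"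
        using pos by (intro mult_left_mono) auto
      moreover have "gen_fun d ?v \<le> gen_fun d x * ((1 - x) / (1 - ?v)) ^ K"
        by (rule gen_fun_growth) (use d x v True in auto)
      ultimately show ?thesis by linarith
    next
      case False
      have "gen_fun d ?v \<le> gen_fun d x"
        by (rule gen_fun_mono_arg[where K = "real K"]) (use d v x Y False in auto)
      also have "\<dots> = gen_fun d x * 1" by simp
      also have "\<dots> \<le> gen_fun d x * (2 + 2 * real j * (1 - x / 1)) ^ K"
      proof (intro mult_left_mono one_le_power)
        have "0 \<le> real j * (1 - x)" using x Y by simp
        then show "1 \<le> 2 + 2 * real j * (1 - x / 1)" by simp
      qed (use pos in auto)
      finally show ?thesis .
    qed
  qed (use Y j in auto)
  then show ?thesis by simp
qed

subsection \<open>Lower bounds for coefficients\<close>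

definition low_const :: "nat \<Rightarrow> real" where
  "low_const K = 1 / (2 * (6 * fact (Suc K)) ^ K)"

lemma low_const_pos: "low_const K > 0"
  by (simp add: low_const_def)

text \<open>
  At Y^A the terms with k >= n contribute at most exp (1-A) p(Y), whereas p(Y^A) is at least
  p(Y) / A^K; for A large in terms of K the terms with k < n must account for half of it.
\<close>

lemma efps_sum_ge:
  assumes d: "\<And>i. i \<ge> 1 \<Longrightarrow> 0 \<le> d i" "\<And>i. i \<ge> 1 \<Longrightarrow> d i \<le> real K" and n: "n \<ge> 1"
  shows "low_const K * gen_fun d (exp (- 1 / real n)) \<le> (\<Sum>k<n. efps d $ k)"
proof -
  define Y where "Y = exp (- 1 / real n)"
  \<comment> \<open>This A satisfies exp (1-A) <= 1/(2 A^K): since e <= 3, A^(K+1) <= (K+1)! exp A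
    <= 3 (K+1)! exp (A-1) = (A/2) exp (A-1). Of the lower bound A^(-K) exactly half then survives,
    and that is \<open>low_const K\<close>.\<close>
  define A where "A = (6 * fact (Suc K) :: nat)"
  have A_real: "real A = 6 * fact (Suc K)"
    unfolding A_def by (simp only: of_nat_mult of_nat_fact of_nat_numeral)
  have A1: "A \<ge> 1" unfolding A_def by (metis One_nat_def Suc_leI fact_gt_zero mult_pos_pos zero_less_numeral)
  have Y: "0 < Y" "Y < 1" using n by (auto simp: Y_def)
  have YA: "0 < Y ^ A" "Y ^ A \<le> Y" "Y ^ A < 1"
    using Y A1 power_decreasing[of 1 A Y] by (auto simp: power_less_one_iff)
  have dK: "\<bar>d i\<bar> \<le> real K" if "i \<ge> 1" for i using d[OF that] by linarith
  have p: "efps d $ k \<ge> 0" for k by (rule efps_nonneg) (use d in auto)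
  have s1: "(\<lambda>k. efps d $ k * (Y ^ A) ^ k) sums gen_fun d (Y ^ A)"
    by (rule efps_sums[OF dK]) (use YA in auto)
  have s2: "(\<lambda>k. efps d $ k * Y ^ k) sums gen_fun d Y"
    by (rule efps_sums[OF dK]) (use Y in auto)
  have s3: "(\<lambda>k. if k \<in> {..<n} then efps d $ k else 0) sums (\<Sum>k<n. efps d $ k)"
    by (rule sums_If_finite_set) auto
  have YAn: "Y ^ (n * (A - 1)) = exp (- real (A - 1))"
    using n by (simp add: Y_def exp_of_nat_mult[symmetric] field_simps)
  have "gen_fun d (Y ^ A) \<le> (\<Sum>k<n. efps d $ k) + exp (- real (A - 1)) * gen_fun d Y"
  proof (rule sums_le[OF _ s1 sums_add[OF s3 sums_mult[OF s2]]])
    fix k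
    show "efps d $ k * (Y ^ A) ^ k
      \<le> (if k \<in> {..<n} then efps d $ k else 0) + exp (- real (A - 1)) * (efps d $ k * Y ^ k)"
    proof (cases "k < n")
      case True
      have "efps d $ k * (Y ^ A) ^ k \<le> efps d $ k"
        using p[of k] Y YA by (intro mult_left_le power_le_one) auto
      also have "\<dots> \<le> efps d $ k + exp (- real (A - 1)) * (efps d $ k * Y ^ k)"
        using p[of k] Y by simp
      finally show ?thesis using True by simp
    next
      case False
      have "(Y ^ A) ^ k = Y ^ (k * (A - 1)) * Y ^ k"
        using A1 by (simp add: power_mult[symmetric] power_add[symmetric] mult.commute algebra_simps diff_mult_distrib2)
      also have "Y ^ (k * (A - 1)) \<le> Y ^ (n * (A - 1))"
        using False Y by (intro power_decreasing mult_right_mono) auto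
      finally have "(Y ^ A) ^ k \<le> exp (- real (A - 1)) * Y ^ k"
        unfolding YAn using Y by simp
      then have "efps d $ k * (Y ^ A) ^ k \<le> efps d $ k * (exp (- real (A - 1)) * Y ^ k)"
        using p[of k] by (rule mult_left_mono)
      then show ?thesis using False by (simp add: mult_ac)
    qed
  qed
  moreover have "gen_fun d Y \<le> gen_fun d (Y ^ A) * real A ^ K"
  proof -
    have "1 + real A * (- (1 - Y)) \<le> (1 + (- (1 - Y))) ^ A"
      by (rule Bernoulli_inequality) (use Y in auto)
    then have "(1 - Y ^ A) / (1 - Y) \<le> real A"
      using Y by (simp add: pos_divide_le_eq algebra_simps)
    then have "((1 - Y ^ A) / (1 - Y)) ^ K \<le> real A ^ K"
      using Y YA by (intro power_mono) auto
    moreover have "gen_fun d Y \<le> gen_fun d (Y ^ A) * ((1 - Y ^ A) / (1 - Y)) ^ K"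
      by (rule gen_fun_growth) (use d Y YA in auto)
    ultimately show ?thesis
      using gen_fun_pos[of d "Y ^ A"] by (meson mult_left_mono order_trans less_imp_le)
  qed
  moreover have "exp (- real (A - 1)) \<le> 1 / (2 * real A ^ K)"
  proof -
    have "real A ^ Suc K \<le> fact (Suc K) * exp (real A)" by (rule power_le_fact_exp) simp
    also have "exp (real A) = exp 1 * exp (real (A - 1))"
      using A1 by (simp add: exp_add[symmetric] of_nat_diff)
    also have "fact (Suc K) * (exp 1 * exp (real (A - 1))) \<le> fact (Suc K) * (3 * exp (real (A - 1)))"
      using exp_le by (intro mult_left_mono mult_right_mono) auto
    also have "\<dots> = real A * (exp (real (A - 1)) / 2)"
      unfolding A_real by simp
    finally have "real A ^ K \<le> exp (real (A - 1)) / 2"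
      using A1 by simp
    then have "1 / exp (real (A - 1)) \<le> 1 / (2 * real A ^ K)"
      using A1 by (intro divide_left_mono) auto
    then show ?thesis by (simp only: exp_minus inverse_eq_divide)
  qed
  ultimately have *: "gen_fun d (Y ^ A) \<le> (\<Sum>k<n. efps d $ k) + 1 / (2 * real A ^ K) * gen_fun d Y"
    "gen_fun d Y \<le> gen_fun d (Y ^ A) * real A ^ K"
    using gen_fun_pos[of d Y] by (meson add_left_mono mult_right_mono order_trans less_imp_le)+
  have "gen_fun d Y / real A ^ K \<le> gen_fun d (Y ^ A)"
    using *(2) A1 by (simp add: pos_divide_le_eq)
  moreover have "1 / (2 * real A ^ K) * gen_fun d Y = gen_fun d Y / real A ^ K - low_const K * gen_fun d Y"
    unfolding low_const_def A_real[symmetric] using A1 by (simp add: field_simps)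
  ultimately show ?thesis using *(1) unfolding Y_def by linarith
qed

text \<open>Here the positive lower bound on the weights acts: replacing every weight in the
  recurrence by l turns the bound for the partial sum into one for a single coefficient.\<close>

lemma efps_ge:
  assumes d: "0 < l" "\<And>i. i \<ge> 1 \<Longrightarrow> l \<le> d i" "\<And>i. i \<ge> 1 \<Longrightarrow> d i \<le> real K" and n: "n \<ge> 1"
  shows "l * low_const K * gen_fun d (exp (- 1 / real n)) \<le> real n * efps d $ n"
proof -
  have d0: "0 \<le> d i" if "i \<ge> 1" for i using d(1) d(2)[OF that] by linarith
  have "l * (low_const K * gen_fun d (exp (- 1 / real n))) \<le> l * (\<Sum>k<n. efps d $ k)"
    by (rule mult_left_mono[OF efps_sum_ge]) (use d d0 n in auto)
  also have "\<dots> \<le> (\<Sum>k<n. d (n - k) * efps d $ k)"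
    unfolding sum_distrib_left
    by (intro sum_mono mult_right_mono d efps_nonneg) (use d0 in auto)
  also have "\<dots> = real n * efps d $ n" using n by (simp add: efps_rec)
  finally show ?thesis by (simp add: mult_ac)
qed

subsection \<open>The weight of a single sum S(f;j)\<close>

text \<open>The l1 norm of an integral is at most the integral of the l1 norm; the fixed signs of
  the values \<open>a k\<close> reduce this to monotonicity of one scalar integral.\<close>

lemma sum_abs_has_integral_le:
  fixes f :: "'k \<Rightarrow> real \<Rightarrow> real"
  assumes "\<And>k. k \<in> S \<Longrightarrow> (f k has_integral a k) T" "finite S" "(B has_integral I) T"
    "\<And>x. x \<in> T \<Longrightarrow> (\<Sum>k\<in>S. \<bar>f k x\<bar>) \<le> B x"
  shows "(\<Sum>k\<in>S. \<bar>a k\<bar>) \<le> I"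
proof -
  have "((\<lambda>x. \<Sum>k\<in>S. sgn (a k) * f k x) has_integral (\<Sum>k\<in>S. sgn (a k) * a k)) T"
    by (intro has_integral_sum has_integral_mult_right assms)
  then have "(\<Sum>k\<in>S. sgn (a k) * a k) \<le> I"
  proof (rule has_integral_le[OF _ assms(3)])
    fix x assume "x \<in> T"
    have "(\<Sum>k\<in>S. sgn (a k) * f k x) \<le> (\<Sum>k\<in>S. \<bar>f k x\<bar>)"
      by (rule sum_mono) (auto simp: sgn_if)
    then show "(\<Sum>k\<in>S. sgn (a k) * f k x) \<le> B x" using assms(4)[OF \<open>x \<in> T\<close>] by linarith
  qed
  then show ?thesis by (simp add: mult.commute abs_sgn)
qed

text \<open>The expansion of the integral of u^(j-1)/p(u) from 0 to z.\<close>

definition kernel_fps :: "(nat \<Rightarrow> real) \<Rightarrow> nat \<Rightarrow> real fps" where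
  "kernel_fps d j = Abs_fps (\<lambda>k. if k < j then 0 else efps (\<lambda>i. - d i) $ (k - j) / real k)"

lemma fps_deriv_kernel_fps: "j \<ge> 1 \<Longrightarrow> fps_deriv (kernel_fps d j) = fps_X ^ (j - 1) * efps (\<lambda>i. - d i)"
  by (auto simp: fps_eq_iff kernel_fps_def fps_X_power_mult_nth)

lemma fps_linear_ode_rec:
  assumes "fps_deriv F = lfps d * F + G" "n \<ge> 1"
  shows "real n * F $ n = (\<Sum>k<n. d (n - k) * F $ k) + G $ (n - 1)"
proof -
  obtain m where n: "n = Suc m" using assms(2) by (cases n) auto
  have "real n * F $ n = fps_deriv F $ m" by (simp add: n)
  also have "\<dots> = (\<Sum>i=0..m. d (Suc i) * F $ (m - i)) + G $ m"
    by (simp add: assms(1) fps_mult_nth lfps_def)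
  also have "(\<Sum>i=0..m. d (Suc i) * F $ (m - i)) = (\<Sum>k<n. d (n - k) * F $ k)"
    by (rule sum.reindex_bij_witness[of _ "\<lambda>i. m - i" "\<lambda>i. m - i"]) (auto simp: n Suc_diff_le)
  finally show ?thesis by (simp add: n)
qed

text \<open>The substitution u = xz, carried out coefficientwise: the term z^l of 1/p picks up the
  integral of x^(j-1+l) over [0,1], that is 1/(j+l), the divisor in
  \<open>kernel_fps\<close>.\<close>

lemma kernel_has_integral:
  assumes j: "j \<ge> 1"
  shows "((\<lambda>x. x ^ (j - 1) * (fps_X ^ j * efps (\<lambda>i. d i * (1 - x ^ i))) $ k)
    has_integral (efps d * kernel_fps d j) $ k) {0..1}"
proof (cases "k < j")
  case True
  then have "(efps d * kernel_fps d j) $ k = 0"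
    unfolding fps_mult_nth by (intro sum.neutral) (auto simp: kernel_fps_def)
  then show ?thesis using True by (simp add: fps_X_power_mult_nth)
next
  case False
  let ?p = "\<lambda>k. efps d $ k" and ?q = "\<lambda>k. efps (\<lambda>i. - d i) $ k"
  have "efps (\<lambda>i. d i * (1 - x ^ i)) $ m = (\<Sum>l=0..m. x ^ l * ?q l * ?p (m - l))" for x m
  proof -
    have "efps (\<lambda>i. d i * (1 - x ^ i)) = efps (\<lambda>i. - d i * x ^ i) * efps d"
      unfolding efps_add[symmetric] by (simp add: algebra_simps)
    then show ?thesis
      by (simp only: fps_mult_nth efps_scale[of "\<lambda>i. - d i"])
  qed
  then have 1: "x ^ (j - 1) * (fps_X ^ j * efps (\<lambda>i. d i * (1 - x ^ i))) $ k
      = (\<Sum>l=0..k-j. ?q l * ?p (k - j - l) * x ^ (j - 1 + l))" for x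
    using False by (simp only: fps_X_power_mult_nth if_False sum_distrib_left power_add mult_ac)
  have pw: "((\<lambda>x. x ^ (j - 1 + l)) has_integral 1 / real (j + l)) {0..1::real}" for l
  proof -
    have "((\<lambda>x. x ^ (j - 1 + l)) has_integral 1 ^ (j + l) / real (j + l) - 0 ^ (j + l) / real (j + l)) {0..1::real}"
      by (rule fundamental_theorem_of_calculus)
         (use j in \<open>auto intro!: derivative_eq_intros simp: has_real_derivative_iff_has_vector_derivative[symmetric]\<close>)
    then show ?thesis using j by (simp add: power_0_left)
  qed
  have "((\<lambda>x. \<Sum>l=0..k-j. ?q l * ?p (k - j - l) * x ^ (j - 1 + l)) has_integral
      (\<Sum>l=0..k-j. ?q l * ?p (k - j - l) * (1 / real (j + l)))) {0..1}"
    by (intro has_integral_sum has_integral_mult_right pw) auto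
  moreover have "(efps d * kernel_fps d j) $ k = (\<Sum>l=0..k-j. ?q l * ?p (k - j - l) * (1 / real (j + l)))"
  proof -
    have "(efps d * kernel_fps d j) $ k = (\<Sum>i=0..k. kernel_fps d j $ i * ?p (k - i))"
      by (subst mult.commute) (simp add: fps_mult_nth)
    also have "\<dots> = (\<Sum>i=j..k. kernel_fps d j $ i * ?p (k - i))"
      by (rule sum.mono_neutral_right) (auto simp: kernel_fps_def)
    also have "\<dots> = (\<Sum>l=0..k-j. ?q l * ?p (k - j - l) * (1 / real (j + l)))"
      by (rule sum.reindex_bij_witness[of _ "\<lambda>l. j + l" "\<lambda>i. i - j"])
         (use False in \<open>auto simp: kernel_fps_def\<close>)
    finally show ?thesis .
  qed
  ultimately show ?thesis unfolding 1 by simp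
qed

definition weight_const :: "nat \<Rightarrow> real" where
  "weight_const K = 2 * 4 ^ K * fact K * exp 2"

text \<open>The first summand comes from 0 <= x <= Y, its 3 being 2 + 1 from the integrals against
  1/W and 1/p; the second comes from Y <= x <= 1.\<close>

definition kernel_const :: "nat \<Rightarrow> real" where
  "kernel_const K = 3 * (exp 1 * 2 ^ K * (8 * exp 1 * (2 + 2 * 2 ^ K))) * weight_const K + exp 1 * 2 ^ K"

lemma weight_const_pos: "weight_const K > 0"
  by (simp add: weight_const_def)

lemma kernel_const_pos: "kernel_const K > 0"
  using weight_const_pos[of K] by (simp add: kernel_const_def add_pos_pos)

lemma one_minus_mult_le: "x \<le> y \<Longrightarrow> y \<le> 1 \<Longrightarrow> 0 \<le> x \<Longrightarrow> 1 - x * y \<le> 2 * (1 - x)" for x y :: real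
proof -
  assume "x \<le> y" "y \<le> 1" "0 \<le> x"
  then have "x * (1 - y) \<le> 1 * (1 - x)" by (intro mult_mono) auto
  then show ?thesis by (simp add: algebra_simps)
qed

lemma kernel_l1_bound:
  assumes t: "0 < t" "t \<le> 1" and d: "\<And>i. i \<ge> 1 \<Longrightarrow> t \<le> d i" "\<And>i. i \<ge> 1 \<Longrightarrow> d i \<le> real K"
    and j: "1 \<le> j" and n: "1 \<le> n"
  defines "Y \<equiv> exp (- 1 / real n)" and "V \<equiv> exp (- 1 / real j)"
  defines "\<gamma> \<equiv> integral {0..Y} (\<lambda>x. x ^ (j - 1) / gen_fun d x)"
  shows "l1 n (efps d * (kernel_fps d j - fps_const \<gamma>))
    \<le> kernel_const K * (gen_fun d Y * real n powr (- t) * real j powr (t - 1) / gen_fun d V + 1 / real n)"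
proof -
  define e where "e i = d i - t" for i
  have e: "0 \<le> e i" "e i \<le> real K" if "i \<ge> 1" for i
    using d(1)[OF that] d(2)[OF that] t by (auto simp: e_def)
  have d0: "0 \<le> d i" if "i \<ge> 1" for i using d(1)[OF that] t by linarith
  have dK: "\<bar>d i\<bar> \<le> real K" if "i \<ge> 1" for i using d(2)[OF that] d0[OF that] by linarith
  have eK: "\<bar>e i\<bar> \<le> real K" if "i \<ge> 1" for i using e[OF that] by linarith
  have Y: "0 < Y" "Y < 1" using n by (auto simp: Y_def)
  have V: "0 < V" "V < 1" using j by (auto simp: V_def)
  define p W :: "real \<Rightarrow> real" where "p = gen_fun d" and "W = gen_fun e"
  have p: "p x > 0" and W: "W x > 0" for x :: real
    by (auto simp: p_def W_def gen_fun_pos)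
  have p_W: "p x = W x * (1 - x) powr (- t)" if "\<bar>x\<bar> < 1" for x :: real
    unfolding p_def W_def e_def by (rule gen_fun_split[OF dK that])
  define q where "q x = fps_X ^ j * efps (\<lambda>i. d i * (1 - x ^ i))" for x
  define h where "h = efps d * kernel_fps d j"
  define F where "F x = q x - fps_const (1 / p x) * efps d" for x
  define M :: real where "M = exp 1 * 2 ^ K * (8 * exp 1 * (2 + 2 * 2 ^ K))"
  have M: "M \<ge> 0" by (simp add: M_def)
  define C where "C = weight_const K"

  have cont: "continuous_on {0..Y} p" "continuous_on {0..Y} W"
    unfolding p_def W_def by (rule continuous_on_gen_fun[of _ "real K"]; use dK eK Y in auto)+
  have int: "(\<lambda>x. x ^ (j - 1) / p x) integrable_on {0..Y}" "(\<lambda>x. x ^ (j - 1) / W x) integrable_on {0..Y}"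
    by (intro integrable_continuous_interval continuous_intros cont; use p W in \<open>simp add: less_imp_neq[symmetric]\<close>)+
  have \<gamma>: "((\<lambda>x. x ^ (j - 1) / p x) has_integral \<gamma>) {0..Y}"
    unfolding \<gamma>_def using int(1) by (simp add: p_def integrable_integral)
  have kern: "((\<lambda>x. x ^ (j - 1) * q x $ k) has_integral h $ k) {0..1}" for k
    unfolding q_def h_def by (rule kernel_has_integral[OF j])
  have int2: "(\<lambda>x. x ^ (j - 1) * q x $ k) integrable_on {Y..1}"
    "(\<lambda>x. x ^ (j - 1) * q x $ k) integrable_on {0..Y}" for k
    by (rule integrable_subinterval_real[OF has_integral_integrable[OF kern[of k]]]; use Y in auto)+
  \<comment> \<open>The split is at Y because \<gamma> stops there: subtracting p(z)/p(x) under the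
    integral up to Y removes exactly \<gamma> p(z).\<close>
  define u v where "u k = integral {0..Y} (\<lambda>x. x ^ (j - 1) * q x $ k)"
    and "v k = integral {Y..1} (\<lambda>x. x ^ (j - 1) * q x $ k)" for k
  have uv: "h $ k = u k + v k" for k
    unfolding u_def v_def
    using Henstock_Kurzweil_Integration.integral_combine[of 0 Y 1 "\<lambda>x. x ^ (j - 1) * q x $ k"] Y kern[of k]
    by (auto simp: integral_unique has_integral_integrable)
  have u_int: "((\<lambda>x. x ^ (j - 1) * F x $ k) has_integral (u k - \<gamma> * efps d $ k)) {0..Y}" for k
  proof -
    have "((\<lambda>x. x ^ (j - 1) * q x $ k - x ^ (j - 1) / p x * efps d $ k) has_integral (u k - \<gamma> * efps d $ k)) {0..Y}"
      unfolding u_def by (intro has_integral_diff has_integral_mult_left \<gamma> integrable_integral int2)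
    then show ?thesis by (simp add: F_def right_diff_distrib)
  qed
  have v_int: "((\<lambda>x. x ^ (j - 1) * q x $ k) has_integral v k) {Y..1}" for k
    unfolding v_def by (intro integrable_integral int2)

  have near: "integral {0..Y} (\<lambda>x. x ^ (j - 1) / p x) \<le> C / (real j * p V)"
    "integral {0..Y} (\<lambda>x. x ^ (j - 1) / W x) \<le> C / (real j * W V)"
    unfolding p_def W_def C_def V_def weight_const_def
    by (rule reciprocal_integral_near; use d0 d e Y j in auto)+

  have "(\<Sum>k\<le>n. \<bar>u k - \<gamma> * efps d $ k\<bar>)
      \<le> M * W Y * (integral {0..Y} (\<lambda>x. x ^ (j - 1) / W x)
          + real j powr t * integral {0..Y} (\<lambda>x. x ^ (j - 1) / p x))"
  proof (rule sum_abs_has_integral_le[OF u_int])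
    show "((\<lambda>x. M * W Y * (x ^ (j - 1) / W x + real j powr t * (x ^ (j - 1) / p x))) has_integral
       M * W Y * (integral {0..Y} (\<lambda>x. x ^ (j - 1) / W x)
          + real j powr t * integral {0..Y} (\<lambda>x. x ^ (j - 1) / p x))) {0..Y}"
      by (intro has_integral_mult_right has_integral_add integrable_integral int)
    fix x assume x: "x \<in> {0..Y}"
    have W_le: "W x \<le> W (x * Y) * 2 ^ K"
    proof -
      have xY: "0 \<le> x * Y" "x * Y \<le> x" using x Y by (auto intro: mult_left_le)
      have "W x \<le> W (x * Y) * ((1 - x * Y) / (1 - x)) ^ K"
        unfolding W_def by (rule gen_fun_growth) (use e x Y xY in auto)
      also have "\<dots> \<le> W (x * Y) * 2 ^ K"
      proof (intro mult_left_mono power_mono)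
        show "(1 - x * Y) / (1 - x) \<le> 2"
          using one_minus_mult_le[of x Y] x Y by (simp add: pos_divide_le_eq)
        show "0 \<le> (1 - x * Y) / (1 - x)" using x Y xY by auto
      qed (use W[of "x * Y"] in auto)
      finally show ?thesis .
    qed
    have "(\<Sum>k\<le>n. efps (\<lambda>i. e i * (1 - x ^ i)) $ k) \<le> exp 1 * (W Y / W (x * Y))"
      unfolding W_def Y_def by (rule damped_sum_le[where K = "real K"]) (use e x Y n in auto)
    also have "\<dots> \<le> exp 1 * (2 ^ K * W Y / W x)"
      using W_le W[of x] W[of "x * Y"] W[of Y]
      by (intro mult_left_mono) (auto simp: field_simps)
    finally have S: "(\<Sum>k\<le>n. efps (\<lambda>i. e i * (1 - x ^ i)) $ k) \<le> exp 1 * (2 ^ K * W Y / W x)" .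
    have "l1 n (F x) \<le> (\<Sum>k\<le>n. efps (\<lambda>i. e i * (1 - x ^ i)) $ k)
       * (8 * exp 1 * (2 + 2 * 2 ^ K) * (1 + (real j * (1 - x)) powr t))"
      unfolding F_def q_def p_def e_def by (rule l1_damped_approx) (use t d x Y j in auto)
    also have "\<dots> \<le> (exp 1 * (2 ^ K * W Y / W x)) * (8 * exp 1 * (2 + 2 * 2 ^ K) * (1 + (real j * (1 - x)) powr t))"
      by (rule mult_right_mono[OF S]) simp
    also have "\<dots> = M * W Y * ((1 + (real j * (1 - x)) powr t) / W x)"
      by (simp add: M_def)
    \<comment> \<open>Since p(x) = W(x) (1-x)^(-t), the factor (1-x)^t turns 1/W into 1/p, so only
      reciprocal integrals of known size remain.\<close>
    also have "(1 + (real j * (1 - x)) powr t) / W x = 1 / W x + real j powr t * (1 / p x)"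
    proof -
      have "p x = W x / (1 - x) powr t"
        using p_W[of x] x Y by (simp add: powr_minus field_simps)
      then show ?thesis using W[of x] x Y by (simp add: powr_mult add_divide_distrib)
    qed
    finally have l1F: "l1 n (F x) \<le> M * W Y * (1 / W x + real j powr t * (1 / p x))" .
    have "(\<Sum>k\<le>n. \<bar>x ^ (j - 1) * F x $ k\<bar>) = x ^ (j - 1) * l1 n (F x)"
      using x by (simp add: l1_def abs_mult sum_distrib_left)
    also have "\<dots> \<le> x ^ (j - 1) * (M * W Y * (1 / W x + real j powr t * (1 / p x)))"
      using x by (intro mult_left_mono l1F) auto
    also have "\<dots> = M * W Y * (x ^ (j - 1) / W x + real j powr t * (x ^ (j - 1) / p x))"
      by (simp add: algebra_simps)
    finally show "(\<Sum>k\<le>n. \<bar>x ^ (j - 1) * F x $ k\<bar>)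
        \<le> M * W Y * (x ^ (j - 1) / W x + real j powr t * (x ^ (j - 1) / p x))" .
  qed auto
  also have "\<dots> \<le> M * W Y * (2 * C * real j powr (t - 1) / p V + C * real j powr (t - 1) / p V)"
  proof (intro mult_left_mono add_mono)
    have jt: "real j powr t / real j = real j powr (t - 1)"
      using j by (simp add: powr_diff)
    \<comment> \<open>The integral against 1/W is of the same order j^(t-1)/p(V) as the other one,
      because (1-V)^(-t) <= (2j)^t.\<close>
    have "1 / W V = (1 - V) powr (- t) / p V"
      using p_W[of V] V W[of V] by (simp add: field_simps)
    also have "(1 - V) powr (- t) = (1 / (1 - V)) powr t"
      using V by (simp add: powr_minus_divide powr_divide)
    also have "(1 / (1 - V)) powr t \<le> (2 * real j) powr t"
    proof (rule powr_mono2)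
      show "1 / (1 - V) \<le> 2 * real j"
        using one_minus_exp_bounds(1)[OF j] V j by (simp add: V_def field_simps)
    qed (use t V in auto)
    also have "\<dots> = 2 powr t * real j powr t" by (simp add: powr_mult)
    also have "\<dots> \<le> 2 powr 1 * real j powr t" using t by (intro mult_right_mono powr_mono) auto
    finally have WV: "1 / W V \<le> 2 * real j powr t / p V"
      using p[of V] by (simp add: divide_right_mono)
    have "integral {0..Y} (\<lambda>x. x ^ (j - 1) / W x) \<le> C / real j * (1 / W V)"
      using near(2) by simp
    also have "\<dots> \<le> C / real j * (2 * real j powr t / p V)"
      using weight_const_pos[of K] by (intro mult_left_mono WV) (auto simp: C_def)
    also have "\<dots> = 2 * C * (real j powr t / real j) / p V" by simp
    finally show "integral {0..Y} (\<lambda>x. x ^ (j - 1) / W x) \<le> 2 * C * real j powr (t - 1) / p V"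
      unfolding jt .
    have "real j powr t * integral {0..Y} (\<lambda>x. x ^ (j - 1) / p x) \<le> real j powr t * (C / (real j * p V))"
      by (intro mult_left_mono near) simp
    also have "\<dots> = C * (real j powr t / real j) / p V" by simp
    finally show "real j powr t * integral {0..Y} (\<lambda>x. x ^ (j - 1) / p x) \<le> C * real j powr (t - 1) / p V"
      unfolding jt .
  qed (use M W[of Y] in auto)
  also have "\<dots> = 3 * M * C * (real j powr (t - 1) / p V) * W Y" by (simp add: algebra_simps)
  also have "\<dots> \<le> 3 * M * C * (real j powr (t - 1) / p V) * (p Y * real n powr (- t))"
  proof (rule mult_left_mono)
    \<comment> \<open>Source of the factor n^(-t): W lacks the singular factor of p, and 1-Y <=
      1/n.\<close>
    have "W Y = p Y * (1 - Y) powr t"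
      using p_W[of Y] Y by (simp add: powr_minus)
    also have "\<dots> \<le> p Y * (1 / real n) powr t"
      using one_minus_exp_bounds(2)[OF n] Y t p[of Y] by (intro mult_left_mono powr_mono2) (auto simp: Y_def)
    also have "(1 / real n) powr t = real n powr (- t)"
      by (simp add: powr_divide powr_minus_divide)
    finally show "W Y \<le> p Y * real n powr (- t)" .
  qed (use M p[of V] weight_const_pos[of K] in \<open>auto simp: C_def\<close>)
  finally have U: "(\<Sum>k\<le>n. \<bar>u k - \<gamma> * efps d $ k\<bar>)
      \<le> 3 * M * C * (p Y * real n powr (- t) * real j powr (t - 1) / p V)"
    by (simp add: mult_ac)

  have V_bound: "(\<Sum>k\<le>n. \<bar>v k\<bar>) \<le> exp 1 * 2 ^ K * (1 - Y)"
  proof (rule sum_abs_has_integral_le[OF v_int])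
    show "((\<lambda>_. exp 1 * 2 ^ K) has_integral exp 1 * 2 ^ K * (1 - Y)) {Y..1}"
      using has_integral_const_real[of "exp 1 * 2 ^ K :: real" Y 1] Y by (simp add: mult.commute)
    fix x assume x: "x \<in> {Y..1}"
    have "p Y \<le> p (x * Y) * 2 ^ K"
    proof -
      have xY: "0 \<le> x * Y" "x * Y \<le> Y" "Y * Y \<le> x * Y" using x Y by (auto intro: mult_left_le_one_le mult_right_mono)
      have "p Y \<le> p (x * Y) * ((1 - x * Y) / (1 - Y)) ^ K"
        unfolding p_def by (rule gen_fun_growth) (use d0 d x Y xY in auto)
      also have "\<dots> \<le> p (x * Y) * 2 ^ K"
      proof (intro mult_left_mono power_mono)
        show "(1 - x * Y) / (1 - Y) \<le> 2"
        proof -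
          have "1 - x * Y \<le> 2 * (1 - Y)" using one_minus_mult_le[of Y Y] xY(3) Y by linarith
          then show ?thesis using Y by (simp add: pos_divide_le_eq)
        qed
        show "0 \<le> (1 - x * Y) / (1 - Y)"
          using xY(2) Y by (intro divide_nonneg_nonneg) linarith+
      qed (use p[of "x * Y"] in auto)
      finally show ?thesis .
    qed
    then have r: "p Y / p (x * Y) \<le> 2 ^ K" using p[of "x * Y"] by (simp add: field_simps)
    have x01: "0 \<le> x" "x \<le> 1" using x Y by auto
    have nonneg: "0 \<le> efps (\<lambda>i. d i * (1 - x ^ i)) $ k" for k
      by (rule efps_nonneg) (use abs_damped_le(1)[of d "real K" x] d0 d x01 in auto)
    have "l1 n (q x) \<le> l1 n (fps_X ^ j) * l1 n (efps (\<lambda>i. d i * (1 - x ^ i)))"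
      unfolding q_def by (rule l1_mult)
    also have "\<dots> \<le> 1 * l1 n (efps (\<lambda>i. d i * (1 - x ^ i)))"
      by (intro mult_right_mono l1_nonneg)
         (auto simp: l1_def fps_X_power_nth if_distrib if_distribR cong: if_cong)
    also have "\<dots> = (\<Sum>k\<le>n. efps (\<lambda>i. d i * (1 - x ^ i)) $ k)"
      using nonneg by (simp add: l1_def)
    also have "\<dots> \<le> exp 1 * (p Y / p (x * Y))"
      unfolding p_def Y_def by (rule damped_sum_le[where K = "real K"]) (use d0 d x01 n in auto)
    also have "\<dots> \<le> exp 1 * 2 ^ K" using r by (intro mult_left_mono) auto
    finally have "l1 n (q x) \<le> exp 1 * 2 ^ K" .
    moreover have "(\<Sum>k\<le>n. \<bar>x ^ (j - 1) * q x $ k\<bar>) = x ^ (j - 1) * l1 n (q x)"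
      using x01 by (simp add: l1_def abs_mult sum_distrib_left)
    moreover have "x ^ (j - 1) * l1 n (q x) \<le> 1 * l1 n (q x)"
      using x01 by (intro mult_right_mono power_le_one l1_nonneg) auto
    ultimately show "(\<Sum>k\<le>n. \<bar>x ^ (j - 1) * q x $ k\<bar>) \<le> exp 1 * 2 ^ K" by linarith
  qed auto
  also have "\<dots> \<le> exp 1 * 2 ^ K * (1 / real n)"
    using one_minus_exp_bounds(2)[OF n] by (intro mult_left_mono) (auto simp: Y_def)
  finally have V': "(\<Sum>k\<le>n. \<bar>v k\<bar>) \<le> exp 1 * 2 ^ K * (1 / real n)" .

  have "l1 n (efps d * (kernel_fps d j - fps_const \<gamma>)) = (\<Sum>k\<le>n. \<bar>(u k - \<gamma> * efps d $ k) + v k\<bar>)"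
  proof -
    have "(efps d * (kernel_fps d j - fps_const \<gamma>)) $ k = (u k - \<gamma> * efps d $ k) + v k" for k
    proof -
      have "(efps d * (kernel_fps d j - fps_const \<gamma>)) $ k = h $ k - \<gamma> * efps d $ k"
        by (simp add: right_diff_distrib h_def mult.commute)
      then show ?thesis by (simp add: uv)
    qed
    then show ?thesis by (simp only: l1_def)
  qed
  also have "\<dots> \<le> (\<Sum>k\<le>n. \<bar>u k - \<gamma> * efps d $ k\<bar>) + (\<Sum>k\<le>n. \<bar>v k\<bar>)"
    by (simp only: sum.distrib[symmetric] sum_mono[OF abs_triangle_ineq])
  also have "\<dots> \<le> 3 * M * C * (p Y * real n powr (- t) * real j powr (t - 1) / p V) + exp 1 * 2 ^ K * (1 / real n)"
    using U V' by (rule add_mono)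
  also have "\<dots> \<le> kernel_const K * (p Y * real n powr (- t) * real j powr (t - 1) / p V) + kernel_const K * (1 / real n)"
  proof (intro add_mono mult_right_mono)
    have "0 \<le> 3 * M * C" using M weight_const_pos[of K] by (simp add: C_def)
    then show "exp 1 * 2 ^ K \<le> kernel_const K"
      unfolding kernel_const_def M_def C_def by linarith
    show "3 * M * C \<le> kernel_const K"
      unfolding kernel_const_def M_def C_def by simp
  qed (use p[of Y] p[of V] in auto)
  finally show ?thesis unfolding p_def by (simp add: distrib_left)
qed

text \<open>K bounds the weights in the recurrence, 2 absorbs the extra 1/n of
  \<open>kernel_l1_bound\<close>, and the denominator is the constant of
  \<open>efps_ge\<close>.\<close>

definition near_const :: "real \<Rightarrow> nat \<Rightarrow> real" where
  "near_const l K = 2 * real K * kernel_const K / (l * low_const K)"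

lemma kernel_near:
  assumes l: "0 < l" and d: "\<And>i. i \<ge> 1 \<Longrightarrow> l \<le> d i" "\<And>i. i \<ge> 1 \<Longrightarrow> d i \<le> real K"
    and j: "1 \<le> j" "j < n"
  defines "t \<equiv> min l 1"
  defines "Y \<equiv> exp (- 1 / real n)" and "V \<equiv> exp (- 1 / real j)"
  defines "\<gamma> \<equiv> integral {0..Y} (\<lambda>x. x ^ (j - 1) / gen_fun d x)"
  shows "\<bar>(efps d * kernel_fps d j) $ n / efps d $ n - \<gamma>\<bar>
    \<le> near_const l K * (real n powr (- t) * real j powr (t - 1) / gen_fun d V)"
proof -
  have t: "0 < t" "t \<le> 1" "t \<le> l" using l by (auto simp: t_def)
  have n: "n \<ge> 1" using j by simp
  have d0: "0 \<le> d i" if "i \<ge> 1" for i using d(1)[OF that] l by linarith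
  have Y: "0 < Y" "Y < 1" using n by (auto simp: Y_def)
  have V: "0 < V" "V < 1" using j by (auto simp: V_def)
  define p :: "real \<Rightarrow> real" where "p = gen_fun d"
  have p: "p x > 0" for x :: real by (simp add: p_def gen_fun_pos)
  define H where "H = efps d * (kernel_fps d j - fps_const \<gamma>)"
  define B where "B = real n powr (- t) * real j powr (t - 1) / p V"
  have B: "B \<ge> 0" using p[of V] by (simp add: B_def)
  have low: "l * low_const K * p Y \<le> real n * efps d $ n"
    unfolding p_def Y_def by (rule efps_ge[OF l d n])
  then have pn: "efps d $ n > 0"
    using l low_const_pos[of K] p[of Y] n
    by (metis (no_types) mult_pos_pos order_less_le_trans zero_less_mult_pos of_nat_0_less_iff less_eq_Suc_le One_nat_def)
  \<comment> \<open>The contribution of Y <= x <= 1 is absorbed into the main term: t <= 1 and j < n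
    give n^(t-1) <= j^(t-1) and p(V) <= p(Y).\<close>
  have "1 / real n \<le> p Y * B"
  proof -
    have "p V \<le> p Y"
      unfolding p_def
      by (rule gen_fun_mono_arg[where K = "real K"]) (use d0 d V Y j in \<open>auto simp: V_def Y_def field_simps\<close>)
    have "1 / real n = real n powr (- t) * real n powr (t - 1)"
      unfolding powr_add[symmetric] using n by (simp add: powr_minus_divide)
    also have "\<dots> \<le> real n powr (- t) * real j powr (t - 1)"
      using t j by (intro mult_left_mono powr_mono2') auto
    also have "\<dots> \<le> (p Y / p V) * (real n powr (- t) * real j powr (t - 1))"
      using mult_right_mono[of 1 "p Y / p V" "real n powr (- t) * real j powr (t - 1)"] \<open>p V \<le> p Y\<close> p[of V]
      by simp
    finally show ?thesis by (simp add: B_def)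
  qed
  have "l1 n H \<le> kernel_const K * (p Y * real n powr (- t) * real j powr (t - 1) / p V + 1 / real n)"
    unfolding H_def \<gamma>_def p_def Y_def V_def
  proof (rule kernel_l1_bound)
    show "t \<le> d i" if "i \<ge> 1" for i using d(1)[OF that] t by linarith
  qed (use t d j n in auto)
  also have "\<dots> \<le> kernel_const K * (2 * (p Y * B))"
    using \<open>1 / real n \<le> p Y * B\<close> kernel_const_pos[of K] by (intro mult_left_mono) (auto simp: B_def)
  finally have l1H: "l1 n H \<le> kernel_const K * (2 * (p Y * B))" .
  have "fps_deriv H = lfps d * H + fps_X ^ (j - 1)"
  proof -
    have "fps_deriv H = lfps d * H + fps_X ^ (j - 1) * (efps d * efps (\<lambda>i. - d i))"
      unfolding H_def using j by (simp add: fps_deriv_kernel_fps fps_deriv_efps algebra_simps)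
    then show ?thesis by (simp add: efps_uminus)
  qed
  from fps_linear_ode_rec[OF this n]
  \<comment> \<open>The forcing term z^(j-1) has no coefficient at n-1, because j < n.\<close>
  have rec: "real n * H $ n = (\<Sum>k<n. d (n - k) * H $ k)" using j by simp
  have "real n * \<bar>H $ n\<bar> = \<bar>\<Sum>k<n. d (n - k) * H $ k\<bar>"
    unfolding rec[symmetric] by (simp add: abs_mult)
  also have "\<dots> \<le> (\<Sum>k<n. \<bar>d (n - k) * H $ k\<bar>)" by (rule sum_abs)
  also have "\<dots> \<le> (\<Sum>k<n. real K * \<bar>H $ k\<bar>)"
  proof (rule sum_mono)
    fix k assume "k \<in> {..<n}"
    then have "n - k \<ge> 1" by simp
    then show "\<bar>d (n - k) * H $ k\<bar> \<le> real K * \<bar>H $ k\<bar>"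
      using d0[of "n - k"] d(2)[of "n - k"] by (simp add: abs_mult mult_right_mono)
  qed
  also have "\<dots> = real K * (\<Sum>k<n. \<bar>H $ k\<bar>)" by (simp add: sum_distrib_left)
  also have "\<dots> \<le> real K * l1 n H"
    unfolding l1_def by (intro mult_left_mono sum_mono2) auto
  also have "\<dots> \<le> real K * (kernel_const K * (2 * (p Y * B)))"
    by (intro mult_left_mono l1H) simp
  finally have Hn: "real n * \<bar>H $ n\<bar> \<le> real K * (kernel_const K * (2 * (p Y * B)))" .
  have "\<bar>(efps d * kernel_fps d j) $ n / efps d $ n - \<gamma>\<bar> = \<bar>H $ n / efps d $ n\<bar>"
    using pn by (simp add: H_def right_diff_distrib mult.commute[of "efps d" "fps_const _"] field_simps)
  also have "\<bar>H $ n / efps d $ n\<bar> = (real n * \<bar>H $ n\<bar>) / (real n * efps d $ n)"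
    using pn n by (simp add: abs_divide)
  also have "\<dots> \<le> real K * (kernel_const K * (2 * (p Y * B))) / (real n * efps d $ n)"
    using pn by (intro divide_right_mono Hn) auto
  also have "\<dots> \<le> real K * (kernel_const K * (2 * (p Y * B))) / (l * low_const K * p Y)"
    using low l low_const_pos[of K] p[of Y] B kernel_const_pos[of K] pn n
    by (intro divide_left_mono) auto
  also have "\<dots> = near_const l K * B"
    using p[of Y] by (simp add: near_const_def)
  finally show ?thesis unfolding B_def p_def .
qed

subsection \<open>Expansion in terms of the sums S(f;j)\<close>

lemma gen_fun_of_real:
  assumes "\<And>i. i \<ge> 1 \<Longrightarrow> \<bar>d i\<bar> \<le> K" "\<bar>x\<bar> < (1::real)"
  shows "gen_fun d (complex_of_real x) = complex_of_real (gen_fun d x)"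
proof -
  have "(\<lambda>j. complex_of_real (d (Suc j) / real (Suc j) * x ^ Suc j)) sums
      complex_of_real (\<Sum>j. d (Suc j) / real (Suc j) * x ^ Suc j)"
    unfolding sums_of_real_iff by (intro summable_sums gen_fun_summable[of d K] assms)
  then show ?thesis by (simp add: gen_fun_def sums_iff exp_of_real)
qed

lemma coeffs_eq_efps:
  assumes d: "\<And>i. i \<ge> 1 \<Longrightarrow> \<bar>d i\<bar> \<le> K"
    and p: "\<And>z::complex. norm z < 1 \<Longrightarrow> (\<lambda>n. of_real (p n) * z ^ n) sums gen_fun d z"
  shows "p = fps_nth (efps d)"
proof -
  have p_sums: "(\<lambda>n. p n * x ^ n) sums gen_fun d x" if "\<bar>x\<bar> < 1" for x :: real
  proof -
    have "(\<lambda>n. complex_of_real (p n * x ^ n)) sums complex_of_real (gen_fun d x)"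
      using p[of "complex_of_real x"] that gen_fun_of_real[of d K x, OF d that] by simp
    then show ?thesis by (simp only: sums_of_real_iff)
  qed
  have diff: "(\<lambda>n. (p n - efps d $ n) * x ^ n) sums 0" if "\<bar>x\<bar> < 1" for x :: real
    using sums_diff[OF p_sums[OF that] efps_sums[of d K x, OF d that]] by (simp add: algebra_simps)
  \<comment> \<open>Index 0 is treated apart, since the isolated-zero argument below is applied only
    to a nonzero coefficient of positive index.\<close>
  have zero: "p 0 = efps d $ 0" using sums_unique2[OF diff[of 0] powser_sums_zero] by simp
  have "p m = efps d $ m" for m
  proof (cases "m = 0")
    case False
    show ?thesis
    proof (rule ccontr)
      assume ne: "p m \<noteq> efps d $ m"
      obtain s where s: "0 < s" "\<And>z. z \<in> cball (0::real) s - {0} \<Longrightarrow> (\<lambda>_. 0::real) z \<noteq> 0"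
        by (rule powser_0_nonzero[of 1 0 "\<lambda>n. p n - efps d $ n" "\<lambda>_. 0" m])
           (use diff ne False in auto)
      from s(2)[of s] s(1) show False by auto
    qed
  qed (use zero in auto)
  then show ?thesis by (simp add: fun_eq_iff)
qed

definition cfps :: "real fps \<Rightarrow> complex fps" where
  "cfps F = Abs_fps (\<lambda>n. complex_of_real (F $ n))"

lemma cfps_nth [simp]: "cfps F $ n = complex_of_real (F $ n)"
  by (simp add: cfps_def)

lemma cfps_mult: "cfps (F * G) = cfps F * cfps G"
  by (simp add: fps_eq_iff fps_mult_nth)

lemma cfps_1: "cfps 1 = 1"
  by (simp add: fps_eq_iff)

lemma S_sum_eq_fps_nth: "S_sum a (fps_nth F) m = (Abs_fps (\<lambda>k. a k * of_nat k) * cfps F) $ m"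
proof -
  have "(\<Sum>k=1..m. a k * of_nat k * complex_of_real (F $ (m - k)))
      = (\<Sum>k=0..m. a k * of_nat k * complex_of_real (F $ (m - k)))"
    by (rule sum.mono_neutral_left) auto
  then show ?thesis by (simp add: S_sum_def fps_mult_nth)
qed

text \<open>Inversion: the S(f;j) are the coefficients of z f'(z) p(z), so multiplying by 1/p
  recovers k a(k), and the division by k is built into \<open>kernel_fps\<close>. Any cut-off n >= k
  is allowed because the kernel vanishes for j > k.\<close>

lemma coeff_eq_sum_kernel:
  assumes "k \<ge> 1" "k \<le> n"
  shows "a k = (\<Sum>j=1..n. S_sum a (fps_nth (efps d)) j * of_real (kernel_fps d j $ k))"
proof -
  let ?A = "Abs_fps (\<lambda>k. a k * of_nat k)" and ?S = "\<lambda>j. S_sum a (fps_nth (efps d)) j"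
  let ?q = "efps (\<lambda>i. - d i)"
  have "?A = ?A * cfps (efps d * ?q)" by (simp add: efps_uminus cfps_1)
  also have "\<dots> = (?A * cfps (efps d)) * cfps ?q" by (simp only: cfps_mult mult.assoc)
  finally have "?A $ k = ((?A * cfps (efps d)) * cfps ?q) $ k" by (rule arg_cong)
  also have "\<dots> = (\<Sum>j=0..k. ?S j * of_real (?q $ (k - j)))"
    unfolding fps_mult_nth[of "_ * _"] S_sum_eq_fps_nth by simp
  also have "\<dots> = (\<Sum>j=1..k. ?S j * of_real (?q $ (k - j)))"
    by (rule sum.mono_neutral_right) (auto simp: S_sum_def not_less_eq_eq)
  finally have "a k = (\<Sum>j=1..k. ?S j * of_real (?q $ (k - j))) / of_nat k"
    using assms(1) by (simp add: field_simps)
  also have "\<dots> = (\<Sum>j=1..k. ?S j * of_real (kernel_fps d j $ k))"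
    by (simp add: sum_divide_distrib kernel_fps_def)
  also have "\<dots> = (\<Sum>j=1..n. ?S j * of_real (kernel_fps d j $ k))"
    by (rule sum.mono_neutral_left) (use assms in \<open>auto simp: kernel_fps_def\<close>)
  finally show ?thesis .
qed

lemma convolution_eq_sum_kernel:
  "(\<Sum>k=0..n. a k * of_real (efps d $ (n - k))) = a 0 * of_real (efps d $ n)
    + (\<Sum>j=1..n. S_sum a (fps_nth (efps d)) j * of_real ((efps d * kernel_fps d j) $ n))"
proof -
  let ?S = "\<lambda>j. S_sum a (fps_nth (efps d)) j" and ?p = "\<lambda>k. complex_of_real (efps d $ k)"
  have "(\<Sum>k=0..n. a k * ?p (n - k)) = a 0 * ?p n + (\<Sum>k=1..n. a k * ?p (n - k))"
    by (simp add: sum.atLeast_Suc_atMost)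
  also have "(\<Sum>k=1..n. a k * ?p (n - k))
      = (\<Sum>k=1..n. \<Sum>j=1..n. ?S j * (of_real (kernel_fps d j $ k) * ?p (n - k)))"
    by (rule sum.cong[OF refl]) (simp add: coeff_eq_sum_kernel[of _ n a d] sum_distrib_right mult.assoc)
  also have "\<dots> = (\<Sum>j=1..n. ?S j * (\<Sum>k=1..n. of_real (kernel_fps d j $ k) * ?p (n - k)))"
    by (subst sum.swap) (simp add: sum_distrib_left)
  also have "\<dots> = (\<Sum>j=1..n. ?S j * of_real ((efps d * kernel_fps d j) $ n))"
  proof (intro sum.cong refl)
    fix j assume j: "j \<in> {1..n}"
    have "(\<Sum>k=1..n. kernel_fps d j $ k * efps d $ (n - k)) = (\<Sum>k=0..n. kernel_fps d j $ k * efps d $ (n - k))"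
      by (rule sum.mono_neutral_left) (use j in \<open>auto simp: kernel_fps_def not_less_eq_eq\<close>)
    also have "\<dots> = (efps d * kernel_fps d j) $ n"
      by (subst mult.commute) (simp add: fps_mult_nth)
    finally show "?S j * (\<Sum>k=1..n. of_real (kernel_fps d j $ k) * ?p (n - k))
        = ?S j * of_real ((efps d * kernel_fps d j) $ n)"
      by (simp flip: of_real_mult of_real_sum)
  qed
  finally show ?thesis .
qed

text \<open>G represents f' p rather than z f' p, hence the index shift from m to
  \<open>Suc m\<close>.\<close>

lemma S_sum_fps:
  assumes a: "\<And>z::complex. norm z < 1 \<Longrightarrow> (\<lambda>n. a n * z ^ n) sums f z"
    and d: "\<And>i. i \<ge> 1 \<Longrightarrow> \<bar>d i\<bar> \<le> K"
  defines "G \<equiv> fps_deriv (Abs_fps a) * cfps (efps d)"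
  shows "fps_conv_radius (Abs_fps a) \<ge> 1" "fps_conv_radius (cfps (efps d)) \<ge> 1"
    "fps_conv_radius G \<ge> 1" "G $ m = S_sum a (fps_nth (efps d)) (Suc m)"
proof -
  have "conv_radius a \<ge> 1"
  proof (rule conv_radius_geI_ex')
    fix r :: real assume "0 < r" "ereal r < 1"
    then show "summable (\<lambda>n. a n * complex_of_real r ^ n)"
      by (intro sums_summable[OF a]) simp
  qed
  then show 1: "fps_conv_radius (Abs_fps a) \<ge> 1" by (simp add: fps_conv_radius_def)
  have "conv_radius (\<lambda>n. norm (cfps (efps d) $ n)) = conv_radius (\<lambda>n. norm (efps d $ n))"
    by simp
  then have "fps_conv_radius (cfps (efps d)) = fps_conv_radius (efps d)"
    unfolding fps_conv_radius_def conv_radius_norm .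
  then show 2: "fps_conv_radius (cfps (efps d)) \<ge> 1"
    using conv_radius_efps(1)[of d K, OF d] by simp
  have "1 \<le> min (fps_conv_radius (fps_deriv (Abs_fps a))) (fps_conv_radius (cfps (efps d)))"
    using 1 2 order_trans[OF 1 fps_conv_radius_deriv] by simp
  also have "\<dots> \<le> fps_conv_radius G" unfolding G_def by (rule fps_conv_radius_mult)
  finally show "fps_conv_radius G \<ge> 1" .
  have "S_sum a (fps_nth (efps d)) (Suc m) = (\<Sum>k=1..Suc m. a k * of_nat k * of_real (efps d $ (Suc m - k)))"
    by (simp add: S_sum_def)
  also have "\<dots> = (\<Sum>i=0..m. of_nat (Suc i) * a (Suc i) * of_real (efps d $ (m - i)))"
    by (rule sum.reindex_bij_witness[of _ Suc "\<lambda>k. k - 1"]) auto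
  also have "\<dots> = G $ m"
    by (simp add: G_def fps_mult_nth)
  finally show "G $ m = S_sum a (fps_nth (efps d)) (Suc m)" by simp
qed

text \<open>f(Y) - f(0) is the integral of f' = G/p, with G integrated term by term. On [0,Y] the
  remainder after N terms is at most the tail of the absolutely convergent series of G at Y, since p
  >= 1 there.\<close>

lemma function_eq_sum_kernel:
  assumes a: "\<And>z::complex. norm z < 1 \<Longrightarrow> (\<lambda>n. a n * z ^ n) sums f z"
    and d: "\<And>i. i \<ge> 1 \<Longrightarrow> 0 \<le> d i" "\<And>i. i \<ge> 1 \<Longrightarrow> d i \<le> K"
    and Y: "0 < Y" "Y < (1::real)"
  shows "(\<lambda>m. S_sum a (fps_nth (efps d)) (Suc m) * of_real (integral {0..Y} (\<lambda>x. x ^ m / gen_fun d x)))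
    sums (f (of_real Y) - a 0)"
proof -
  define A where "A = Abs_fps a"
  define G where "G = fps_deriv A * cfps (efps d)"
  have dK: "\<bar>d i\<bar> \<le> K" if "i \<ge> 1" for i using d[OF that] by linarith
  note R = S_sum_fps[of a f d K, OF a dK, folded A_def, folded G_def]
  have rad: "ereal (norm (complex_of_real x)) < fps_conv_radius A"
    "ereal (norm (complex_of_real x)) < fps_conv_radius (fps_deriv A)"
    "ereal (norm (complex_of_real x)) < fps_conv_radius (cfps (efps d))"
    "ereal (norm (complex_of_real x)) < fps_conv_radius G" if "x \<in> {0..Y}" for x
  proof -
    have "ereal (norm (complex_of_real x)) < 1" using that Y by simp
    then show "ereal (norm (complex_of_real x)) < fps_conv_radius A"
      "ereal (norm (complex_of_real x)) < fps_conv_radius (fps_deriv A)"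
      "ereal (norm (complex_of_real x)) < fps_conv_radius (cfps (efps d))"
      "ereal (norm (complex_of_real x)) < fps_conv_radius G"
      using R(1-3) fps_conv_radius_deriv[of A] by (blast intro: order_less_le_trans)+
  qed
  define p :: "real \<Rightarrow> real" where "p = gen_fun d"
  define g where "g m = integral {0..Y} (\<lambda>x. x ^ m / p x)" for m
  have p1: "p x \<ge> 1" if "x \<in> {0..Y}" for x
    using gen_fun_mono_arg[of d K 0 x] d that Y by (auto simp: p_def gen_fun_def)
  have p_eval: "eval_fps (cfps (efps d)) (of_real x) = of_real (p x)" if "x \<in> {0..Y}" for x
  proof -
    have "(\<lambda>n. complex_of_real (efps d $ n * x ^ n)) sums complex_of_real (p x)"
      unfolding sums_of_real_iff p_def by (rule efps_sums[of d K]) (use dK that Y in auto)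
    then show ?thesis by (simp add: eval_fps_def sums_iff)
  qed
  have der: "((\<lambda>x. eval_fps (fps_deriv A) (complex_of_real x)) has_integral
      (eval_fps A (of_real Y) - eval_fps A (of_real 0))) {0..Y}"
    by (rule fundamental_theorem_of_calculus)
       (use Y rad in \<open>auto intro!: has_vector_derivative_real_field has_field_derivative_eval_fps\<close>)
  have evalA: "eval_fps A (of_real Y) - eval_fps A (of_real 0) = f (of_real Y) - a 0"
    using a[of "of_real Y"] Y by (simp add: eval_fps_def A_def sums_iff eval_fps_at_0)
  have g_int: "((\<lambda>x. complex_of_real (x ^ m / p x)) has_integral complex_of_real (g m)) {0..Y}" for m
  proof -
    have "continuous_on {0..Y} p"
      unfolding p_def by (rule continuous_on_gen_fun[of d K]) (use dK Y in auto)
    moreover have "p x \<noteq> 0" for x unfolding p_def using gen_fun_pos[of d x] by simp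
    ultimately have "(\<lambda>x. x ^ m / p x) integrable_on {0..Y}"
      by (intro integrable_continuous_interval continuous_intros) auto
    then have "((\<lambda>x. x ^ m / p x) has_integral g m) {0..Y}"
      unfolding g_def by (rule integrable_integral)
    then have "(complex_of_real \<circ> (\<lambda>x. x ^ m / p x) has_integral complex_of_real (g m)) {0..Y}"
      by (rule has_integral_linear) (rule bounded_linear_of_real)
    then show ?thesis by (simp add: o_def)
  qed
  have sumG: "summable (\<lambda>m. norm (G $ m) * Y ^ m)"
    using norm_summable_fps[OF rad(4)[of Y]] Y by (simp add: norm_mult norm_power)
  define \<tau> where "\<tau> N = (\<Sum>m. norm (G $ m) * Y ^ m) - (\<Sum>m<N. norm (G $ m) * Y ^ m)" for N
  have bound: "norm (f (of_real Y) - a 0 - (\<Sum>m<N. G $ m * of_real (g m))) \<le> \<tau> N * Y" for N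
  proof -
    have tail: "\<tau> N = (\<Sum>m. norm (G $ (m + N)) * Y ^ (m + N))"
      unfolding \<tau>_def by (rule suminf_minus_initial_segment[symmetric]) (rule sumG)
    have sumN: "summable (\<lambda>m. norm (G $ (m + N)) * Y ^ (m + N))"
      by (rule summable_ignore_initial_segment[OF sumG])
    have "((\<lambda>x. eval_fps (fps_deriv A) (complex_of_real x) - (\<Sum>m<N. G $ m * of_real (x ^ m / p x))) has_integral
        (f (of_real Y) - a 0 - (\<Sum>m<N. G $ m * of_real (g m)))) (cbox 0 Y)"
      using der unfolding evalA cbox_interval
      by (intro has_integral_diff has_integral_sum has_integral_mult_right g_int) auto
    then have "norm (f (of_real Y) - a 0 - (\<Sum>m<N. G $ m * of_real (g m))) \<le> \<tau> N * measure lborel (cbox 0 Y)"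
    proof (rule has_integral_bound[rotated])
      show "0 \<le> \<tau> N" unfolding tail using Y by (intro suminf_nonneg sumN) auto
      fix x :: real assume "x \<in> cbox 0 Y"
      then have x: "x \<in> {0..Y}" by simp
      have "eval_fps G (of_real x) = eval_fps (fps_deriv A) (of_real x) * of_real (p x)"
        unfolding G_def by (subst eval_fps_mult) (use rad[OF x] p_eval[OF x] in auto)
      then have "eval_fps (fps_deriv A) (complex_of_real x) = eval_fps G (of_real x) / of_real (p x)"
        using p1[OF x] by (simp add: field_simps)
      moreover have "(\<Sum>m<N. G $ m * of_real (x ^ m / p x)) = (\<Sum>m<N. G $ m * of_real x ^ m) / of_real (p x)"
        by (simp add: sum_divide_distrib)
      ultimately have *: "eval_fps (fps_deriv A) (complex_of_real x) - (\<Sum>m<N. G $ m * of_real (x ^ m / p x))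
          = (eval_fps G (of_real x) - (\<Sum>m<N. G $ m * of_real x ^ m)) / of_real (p x)"
        by (simp add: diff_divide_distrib)
      have "eval_fps G (of_real x) - (\<Sum>m<N. G $ m * of_real x ^ m) = (\<Sum>m. G $ (m + N) * of_real x ^ (m + N))"
        unfolding eval_fps_def
        by (rule suminf_minus_initial_segment[symmetric]) (rule summable_fps[OF rad(4)[OF x]])
      also have "norm \<dots> \<le> \<tau> N"
        unfolding tail
      proof (rule norm_suminf_le[OF _ sumN])
        fix m
        show "norm (G $ (m + N) * complex_of_real x ^ (m + N)) \<le> norm (G $ (m + N)) * Y ^ (m + N)"
          using x unfolding norm_mult norm_power by (intro mult_left_mono power_mono) auto
      qed
      finally have "norm (eval_fps G (of_real x) - (\<Sum>m<N. G $ m * of_real x ^ m)) \<le> \<tau> N" .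
      moreover have "norm (eval_fps G (of_real x) - (\<Sum>m<N. G $ m * of_real x ^ m)) / p x
          \<le> norm (eval_fps G (of_real x) - (\<Sum>m<N. G $ m * of_real x ^ m)) / 1"
        using p1[OF x] by (intro divide_left_mono) auto
      ultimately show "norm (eval_fps (fps_deriv A) (complex_of_real x) - (\<Sum>m<N. G $ m * of_real (x ^ m / p x))) \<le> \<tau> N"
        unfolding * norm_divide using p1[OF x] by simp
    qed
    then show ?thesis using Y by simp
  qed
  have "(\<lambda>N. \<tau> N * Y) \<longlonglongrightarrow> ((\<Sum>m. norm (G $ m) * Y ^ m) - (\<Sum>m. norm (G $ m) * Y ^ m)) * Y"
    unfolding \<tau>_def by (intro tendsto_intros summable_LIMSEQ sumG)
  then have "(\<lambda>N. \<tau> N * Y) \<longlonglongrightarrow> 0" by simp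
  then have "(\<lambda>N. f (of_real Y) - a 0 - (\<Sum>m<N. G $ m * of_real (g m))) \<longlonglongrightarrow> 0"
    by (rule Lim_null_comparison[rotated]) (simp add: bound)
  then have "(\<lambda>N. f (of_real Y) - a 0 - (f (of_real Y) - a 0 - (\<Sum>m<N. G $ m * of_real (g m))))
      \<longlonglongrightarrow> f (of_real Y) - a 0 - 0"
    by (intro tendsto_diff tendsto_const)
  then have "(\<lambda>m. G $ m * of_real (g m)) sums (f (of_real Y) - a 0)"
    by (simp add: sums_def)
  then show ?thesis by (simp add: R(4) g_def p_def)
qed

section \<open>Combination of the weights for j < n, j = n and j > n\<close>

theorem theorem9:
  fixes dminus dplus :: real
  assumes "0 < dminus"
  shows "\<exists>c::real. \<forall>(d :: nat \<Rightarrow> real) (p :: nat \<Rightarrow> real) (a :: nat \<Rightarrow> complex) (f :: complex \<Rightarrow> complex).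
    (\<forall>j\<ge>1. dminus < d j \<and> d j < dplus) \<longrightarrow>
    (\<forall>z::complex. norm z < 1 \<longrightarrow> (\<lambda>n. of_real (p n) * z ^ n) sums gen_fun d z) \<longrightarrow>
    f analytic_on ball 0 1 \<longrightarrow>
    (\<forall>z::complex. norm z < 1 \<longrightarrow> (\<lambda>n. a n * z ^ n) sums f z) \<longrightarrow>
    (\<forall>n::nat. n \<ge> 1 \<longrightarrow>
      (let \<theta> = min dminus 1 in
        norm ((1 / of_real (p n)) * (\<Sum>k = 0..n. a k * of_real (p (n - k)))
              - f (of_real (exp (- 1 / real n)))
              - S_sum a p n / (of_nat n * of_real (p n)))
        \<le> c * (1 / real n powr \<theta> *
                  (\<Sum>j = 1..n. norm (S_sum a p j) / gen_fun d (exp (- 1 / real j)) * real j powr (\<theta> - 1))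
               + 1 / gen_fun d (exp (- 1 / real n)) *
                  (\<Sum>\<^sub>\<infinity>j\<in>{n<..}. norm (S_sum a p j) / real j * exp (- real j / real n)))))"
proof -
  define K where "K = nat \<lceil>dplus\<rceil>"
  define t where "t = min dminus 1"
  \<comment> \<open>Fixed before d, p, a, f and n are chosen. The absolute value makes c dominate
    both constants without a sign argument for \<open>near_const\<close>.\<close>
  define c where "c = \<bar>near_const dminus K\<bar> + weight_const K"
  have K: "dplus \<le> real K" unfolding K_def by linarith
  have t: "t \<le> 1" by (simp add: t_def)
  show ?thesis
  proof (rule exI[of _ c], intro allI impI)
    fix d :: "nat \<Rightarrow> real" and p :: "nat \<Rightarrow> real" and a :: "nat \<Rightarrow> complex" and f :: "complex \<Rightarrow> complex" and n :: nat
    assume d: "\<forall>j\<ge>1. dminus < d j \<and> d j < dplus"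
      and p: "\<forall>z::complex. norm z < 1 \<longrightarrow> (\<lambda>n. of_real (p n) * z ^ n) sums gen_fun d z"
      and a: "\<forall>z::complex. norm z < 1 \<longrightarrow> (\<lambda>n. a n * z ^ n) sums f z"
      and n: "n \<ge> 1"
    have dl: "dminus \<le> d i" and dK: "d i \<le> real K" and d0: "0 \<le> d i" and dabs: "\<bar>d i\<bar> \<le> real K" if "i \<ge> 1" for i
    proof -
      have "dminus < d i" "d i < dplus" using d that by auto
      then show "dminus \<le> d i" "d i \<le> real K" "0 \<le> d i" "\<bar>d i\<bar> \<le> real K"
        using K assms by linarith+
    qed
    have p_eq: "p = fps_nth (efps d)"
      by (rule coeffs_eq_efps[of d "real K"]) (use dabs p in auto)
    define Y where "Y = exp (- 1 / real n)"
    have Y: "0 < Y" "Y < 1" using n by (auto simp: Y_def)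
    have Y_power: "Y ^ j = exp (- real j / real n)" for j
      by (simp add: Y_def exp_of_nat_mult[symmetric])
    define P :: "real \<Rightarrow> real" where "P = gen_fun d"
    have P: "P x > 0" for x unfolding P_def by (rule gen_fun_pos)
    define S where "S = S_sum a p"
    define g where "g j = integral {0..Y} (\<lambda>x. x ^ (j - 1) / P x)" for j
    define h where "h j = (efps d * kernel_fps d j) $ n" for j
    have pn: "p n > 0"
    proof -
      have "0 < dminus * low_const K * gen_fun d (exp (- 1 / real n))"
        using assms low_const_pos[of K] gen_fun_pos[of d] by simp
      also have "\<dots> \<le> real n * efps d $ n"
        by (rule efps_ge[OF assms dl dK n])
      finally show ?thesis using n by (simp add: p_eq zero_less_mult_iff)
    qed
    have g_nonneg: "0 \<le> g j" for j
    proof (cases "(\<lambda>x. x ^ (j - 1) / P x) integrable_on {0..Y}")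
      case True
      then show ?thesis unfolding g_def
        by (rule integral_nonneg) (use P in \<open>auto simp: less_imp_le\<close>)
    qed (simp add: g_def not_integrable_integral)
    have far: "g j \<le> weight_const K / P Y * (exp (- real j / real n) / real j)" if "n \<le> j" for j
    proof -
      have "g j \<le> 2 * 4 ^ K * fact K * exp 2 * Y ^ j / (real j * P Y)"
        unfolding g_def P_def Y_def by (rule reciprocal_integral_far) (use d0 dK n that in auto)
      then show ?thesis by (simp add: weight_const_def Y_power field_simps)
    qed
    have near: "\<bar>h j / p n - g j\<bar> \<le> c * (1 / real n powr t * (real j powr (t - 1) / P (exp (- 1 / real j))))"
      if "1 \<le> j" "j < n" for j
    proof -
      have "\<bar>h j / p n - g j\<bar> \<le> near_const dminus K * (real n powr (- t) * real j powr (t - 1) / P (exp (- 1 / real j)))"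
        unfolding h_def p_eq g_def P_def Y_def t_def by (rule kernel_near[OF assms dl dK that])
      also have "\<dots> \<le> c * (real n powr (- t) * real j powr (t - 1) / P (exp (- 1 / real j)))"
        using P[of "exp (- 1 / real j)"] weight_const_pos[of K]
        by (intro mult_right_mono) (auto simp: c_def)
      finally show ?thesis by (simp add: powr_minus_divide)
    qed

    define b where "b j = norm (S j) / real j * exp (- real j / real n)" for j
    define B where "B = infsum b {n<..}"
    define D where "D j = norm (S j) / P (exp (- 1 / real j)) * real j powr (t - 1)" for j

    have f_sums: "(\<lambda>m. S (Suc m) * of_real (g (Suc m))) sums (f (of_real Y) - a 0)"
      using function_eq_sum_kernel[of a f d "real K" Y] a d0 dK Y
      by (simp add: S_def p_eq g_def P_def)
    \<comment> \<open>Convergence has to be established, as \<open>infsum\<close> would otherwise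
      default to 0. It follows from absolute convergence of the series of f' p at Y.\<close>
    have b_summable: "summable (\<lambda>m. b (m + Suc n))"
    proof -
      let ?G = "fps_deriv (Abs_fps a) * cfps (efps d)"
      have R: "fps_conv_radius ?G \<ge> 1" "\<And>m. ?G $ m = S (Suc m)"
        unfolding S_def p_eq by (rule S_sum_fps[of a f d "real K"]; use a dabs in auto)+
      have "ereal (norm (complex_of_real Y)) < fps_conv_radius ?G"
        using Y R(1) by (intro order_less_le_trans[OF _ R(1)]) simp
      from norm_summable_fps[OF this]
      have "summable (\<lambda>m. norm (S (Suc m)) * Y ^ m)"
        using Y by (simp add: R(2) norm_mult norm_power)
      then have "summable (\<lambda>m. norm (S (Suc (m + n))) * Y ^ (m + n))"
        by (rule summable_ignore_initial_segment)
      then show ?thesis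
      proof (rule summable_comparison_test'[where N = 0])
        fix m
        have "b (m + Suc n) = norm (S (Suc (m + n))) * (Y ^ Suc (m + n) / real (Suc (m + n)))"
          unfolding b_def Y_power by simp
        also have "\<dots> \<le> norm (S (Suc (m + n))) * (Y ^ (m + n) / 1)"
          using Y by (intro mult_left_mono frac_le power_decreasing) auto
        finally show "norm (b (m + Suc n)) \<le> norm (S (Suc (m + n))) * Y ^ (m + n)"
          by (simp add: b_def)
      qed
    qed
    have B_eq: "B = (\<Sum>m. b (m + Suc n))"
    proof -
      have "bij_betw (\<lambda>m. m + Suc n) UNIV {n<..}"
        by (rule bij_betw_byWitness[of _ "\<lambda>k. k - Suc n"]) auto
      then have "B = infsum (\<lambda>m. b (m + Suc n)) UNIV"
        unfolding B_def by (rule infsum_reindex_bij_betw[symmetric])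
      also have "\<dots> = (\<Sum>m. b (m + Suc n))"
        by (rule infsumI, rule norm_summable_imp_has_sum)
           (use b_summable in \<open>auto simp: b_def intro: summable_sums\<close>)
      finally show ?thesis .
    qed
    have tail_sums: "(\<lambda>m. S (m + Suc n) * of_real (g (m + Suc n))) sums
        (f (of_real Y) - a 0 - (\<Sum>j=1..n. S j * of_real (g j)))"
      using sums_split_initial_segment[OF f_sums, of n]
      by (simp add: sum.atLeast1_atMost_eq add.commute)
    have tail: "norm (f (of_real Y) - a 0 - (\<Sum>j=1..n. S j * of_real (g j))) \<le> weight_const K / P Y * B"
    proof -
      have "norm (f (of_real Y) - a 0 - (\<Sum>j=1..n. S j * of_real (g j)))
          = norm (\<Sum>m. S (m + Suc n) * of_real (g (m + Suc n)))"
        using tail_sums by (simp add: sums_iff)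
      also have "\<dots> \<le> (\<Sum>m. weight_const K / P Y * b (m + Suc n))"
      proof (rule norm_suminf_le)
        fix m
        have "norm (S (m + Suc n) * of_real (g (m + Suc n))) = norm (S (m + Suc n)) * g (m + Suc n)"
          using g_nonneg by (simp add: norm_mult)
        also have "\<dots> \<le> norm (S (m + Suc n)) * (weight_const K / P Y * (exp (- real (m + Suc n) / real n) / real (m + Suc n)))"
          by (intro mult_left_mono far) auto
        also have "\<dots> = weight_const K / P Y * b (m + Suc n)"
          by (simp add: b_def mult_ac)
        finally show "norm (S (m + Suc n) * of_real (g (m + Suc n))) \<le> weight_const K / P Y * b (m + Suc n)" .
      qed (intro summable_mult b_summable)
      also have "\<dots> = weight_const K / P Y * B"
        unfolding B_eq by (rule suminf_mult[OF b_summable])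
      finally show ?thesis .
    qed

    have B_nonneg: "B \<ge> 0" unfolding B_def by (intro infsum_nonneg) (auto simp: b_def)
    have c: "weight_const K \<le> c" "c \<ge> 0" using weight_const_pos[of K] by (auto simp: c_def)
    have kern_n: "h n = 1 / real n"
    proof -
      have "h n = (\<Sum>i=0..n. efps d $ i * kernel_fps d n $ (n - i))"
        by (simp add: h_def fps_mult_nth)
      also have "\<dots> = (\<Sum>i\<in>{0}. efps d $ i * kernel_fps d n $ (n - i))"
        by (rule sum.mono_neutral_right) (use n in \<open>auto simp: kernel_fps_def\<close>)
      finally show ?thesis by (simp add: kernel_fps_def)
    qed
    \<comment> \<open>The net weight of S(f;j) for j <= n, with the subtracted term charged to j =
      n; there it cancels h(n)/p(n) and leaves -g(n).\<close>
    define r where "r j = h j / p n - g j - (if j = n then 1 / (real n * p n) else 0)" for j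
    have r_le: "norm (S j) * \<bar>r j\<bar> \<le> c * (1 / real n powr t * D j)" if "j \<in> {1..n}" for j
    proof (cases "j = n")
      case False
      have "norm (S j) * \<bar>r j\<bar> \<le> norm (S j) * (c * (1 / real n powr t * (real j powr (t - 1) / P (exp (- 1 / real j)))))"
        using near[of j] that False by (intro mult_left_mono) (auto simp: r_def)
      then show ?thesis by (simp add: D_def mult_ac)
    next
      case True
      have "\<bar>r j\<bar> = g n" using True kern_n g_nonneg[of n] by (simp add: r_def)
      also have "\<dots> \<le> weight_const K / P Y * (exp (- real n / real n) / real n)" by (rule far) simp
      also have "\<dots> \<le> c / P Y * (1 / real n)"
        using c P[of Y] by (intro mult_mono divide_right_mono) auto
      \<comment> \<open>This rewriting puts j = n into the same form as the terms with j < n, since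
        Y is also exp (-1/j) there.\<close>
      also have "1 / real n = 1 / real n powr t * real n powr (t - 1)"
        using n by (simp add: powr_diff)
      finally have "norm (S j) * \<bar>r j\<bar> \<le> norm (S j) * (c / P Y * (1 / real n powr t * real n powr (t - 1)))"
        by (rule mult_left_mono) simp
      then show ?thesis using True by (simp add: D_def Y_def mult_ac)
    qed

    define LHS where "LHS = (1 / of_real (p n)) * (\<Sum>k = 0..n. a k * of_real (p (n - k)))
              - f (of_real (exp (- 1 / real n))) - S_sum a p n / (of_nat n * of_real (p n))"
    have conv: "(\<Sum>k=0..n. a k * of_real (p (n - k)))
        = a 0 * of_real (p n) + (\<Sum>j=1..n. S j * of_real (h j))"
      unfolding S_def h_def p_eq by (rule convolution_eq_sum_kernel)
    have "LHS = (\<Sum>j=1..n. S j * of_real (r j)) - (f (of_real Y) - a 0 - (\<Sum>j=1..n. S j * of_real (g j)))"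
    proof -
      have "(\<Sum>j=1..n. S j * of_real (r j)) = (\<Sum>j=1..n. S j * of_real (h j) / of_real (p n))
          - (\<Sum>j=1..n. S j * of_real (g j)) - (\<Sum>j=1..n. if j = n then S n / (of_nat n * of_real (p n)) else 0)"
        unfolding sum_subtractf[symmetric]
        by (rule sum.cong) (auto simp: r_def algebra_simps)
      also have "(\<Sum>j=1..n. if j = n then S n / (of_nat n * of_real (p n)) else 0) = S n / (of_nat n * of_real (p n))"
        using n by simp
      finally have "(\<Sum>j=1..n. S j * of_real (r j)) = (\<Sum>j=1..n. S j * of_real (h j)) / of_real (p n)
          - (\<Sum>j=1..n. S j * of_real (g j)) - S n / (of_nat n * of_real (p n))"
        by (simp only: sum_divide_distrib)
      then show ?thesis
        unfolding LHS_def conv using pn by (simp add: S_def Y_def add_divide_distrib)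
    qed
    then have "norm LHS \<le> norm (\<Sum>j=1..n. S j * of_real (r j))
        + norm (f (of_real Y) - a 0 - (\<Sum>j=1..n. S j * of_real (g j)))"
      by (simp only: norm_triangle_ineq4)
    also have "\<dots> \<le> (\<Sum>j=1..n. c * (1 / real n powr t * D j)) + c / P Y * B"
    proof (rule add_mono)
      show "norm (\<Sum>j=1..n. S j * of_real (r j)) \<le> (\<Sum>j=1..n. c * (1 / real n powr t * D j))"
        by (rule order_trans[OF norm_sum], rule sum_mono) (use r_le in \<open>simp add: norm_mult\<close>)
      show "norm (f (of_real Y) - a 0 - (\<Sum>j=1..n. S j * of_real (g j))) \<le> c / P Y * B"
        using tail by (rule order_trans) (use c P[of Y] B_nonneg in \<open>intro mult_right_mono divide_right_mono, auto\<close>)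
    qed
    also have "\<dots> = c * (1 / real n powr t * (\<Sum>j=1..n. D j) + 1 / P Y * B)"
      by (simp add: sum_distrib_left distrib_left)
    finally show "let \<theta> = min dminus 1 in
        norm ((1 / of_real (p n)) * (\<Sum>k = 0..n. a k * of_real (p (n - k)))
              - f (of_real (exp (- 1 / real n)))
              - S_sum a p n / (of_nat n * of_real (p n)))
        \<le> c * (1 / real n powr \<theta> *
                  (\<Sum>j = 1..n. norm (S_sum a p j) / gen_fun d (exp (- 1 / real j)) * real j powr (\<theta> - 1))
               + 1 / gen_fun d (exp (- 1 / real n)) *
                  (\<Sum>\<^sub>\<infinity>j\<in>{n<..}. norm (S_sum a p j) / real j * exp (- real j / real n)))"
      unfolding Let_def t_def[symmetric] LHS_def B_def D_def b_def P_def S_def Y_def .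
  qed
qed

end
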